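(* Suppose that $d\leq 2$, and let $\gamma_{\mathbf{k}}$, $\mathbf{k} \in \Lambda\setminus\{0\}$, be any sequence of complex numbers such that $\gamma_{-\mathbf{k}} = \bar{\gamma}_{\mathbf{k}}$. Set $\gamma=\{\gamma_{\mathbf{k}}\}_{\mathbf{k} \in \Lambda}$ where $\gamma_0=1$, and let $c \in \mathfrak{C}_+$. Then for any $\lambda > 0$ there exists a unique solution $(\hat{P}, \hat{Q})$ to the strictly convex optimization problem to minimize $$\mathbb{J}_{\lambda}(P,Q) = \langle c, q \rangle - \langle \gamma, p \rangle + \int_{\mathbb{T}^d} P \log \left(\frac{P}{Q}\right) dm - \lambda \int_{\mathbb{T}^d} \log P\, dm$$ subject to $P \in \mathfrak{P}_{+,\circ}$ and $Q \in \mathfrak{P}_+$. Moreover, $\Phi = \hat{P}/\hat{Q}$ fulfills the covariance matching $$c_{\mathbf{k}}=\int_{\mathbb{T}^d}e^{i(\mathbf{k},\boldsymbol{\theta})}\Phi\,dm,\quad \mathbf{k}\in\Lambda,$$ and approximately fulfills the cepstral matching, in the sense that for $\mathbf{k}\in\Lambda\setminus\{0\}$ $$\gamma_{\mathbf{k}} + \varepsilon_{\mathbf{k}} = \int_{\mathbb{T}^d} e^{i (\mathbf{k},\boldsymbol{\theta})} \log \Phi \,dm,\quad\text{where } \varepsilon_{\mathbf{k}} = \lambda \int_{\mathbb{T}^d} e^{i(\mathbf{k}, \boldsymbol{\theta})} \hat{P}^{-1}\, dm.$$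
   Context: Let $d\ge 1$, $\mathbb{T}=(-\pi,\pi]$, $\boldsymbol{\theta}=(\theta_1,\dots,\theta_d)$, $e^{i\boldsymbol{\theta}}=(e^{i\theta_1},\dots,e^{i\theta_d})$, $(\mathbf{k},\boldsymbol{\theta})=\sum_{j=1}^d k_j\theta_j$, and $dm(\boldsymbol{\theta})=(1/2\pi)^d\prod_{j=1}^d d\theta_j$. The index set $\Lambda\subset\mathbb{Z}^d$ is finite with $0\in\Lambda$ and $-\Lambda=\Lambda$. Trigonometric polynomials are $P(e^{i\boldsymbol{\theta}})=\sum_{\mathbf{k}\in\Lambda}p_{\mathbf{k}}e^{-i(\mathbf{k},\boldsymbol{\theta})}$ with $p_{-\mathbf{k}}=\bar p_{\mathbf{k}}$ (real valued), identified with their coefficient vector $p=(p_{\mathbf{k}})_{\mathbf{k}\in\Lambda}$ (similarly $Q\leftrightarrow q$). $\mathfrak{P}_+$ is the convex cone of such polynomials that are positive for all $\boldsymbol{\theta}\in\mathbb{T}^d$; $\bar{\mathfrak{P}}_+$ is its closure. $\mathfrak{P}_{+,\circ}=\{P\in\mathfrak{P}_+\mid p_0=1\}$. Sequences $c=(c_{\mathbf{k}})_{\mathbf{k}\in\Lambda}$ are complex with $c_{-\mathbf{k}}=\bar c_{\mathbf{k}}$; $\langle c,p\rangle=\sum_{\mathbf{k}\in\Lambda}c_{\mathbf{k}}\bar p_{\mathbf{k}}$, and likewise for $\langle\gamma,p\rangle$. $\mathfrak{C}_+=\{c\mid\langle c,p\rangle>0\text{ for all }P\in\bar{\mathfrak{P}}_+\setminus\{0\}\}$.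 *)

theory Defs
  imports "HOL-Analysis.Analysis"
begin

text \<open>
  Multi-indices are vectors in \<open>int ^ 'd\<close>, with \<open>d = CARD('d)\<close>.
  A sequence indexed by the finite set \<open>\<Lambda>\<close> is a total function on multi-indices; for data
  sequences (\<open>c\<close> and \<open>\<gamma>\<close>) only the values on \<open>\<Lambda>\<close> matter, while coefficient vectors of
  trigonometric polynomials are required to vanish off \<open>\<Lambda>\<close>, so that equality of such functions
  is equality of polynomials.
\<close>

type_synonym 'd coeffs = "int ^ 'd \<Rightarrow> complex"

definition index_set :: "(int ^ 'd) set \<Rightarrow> bool" where
  "index_set \<Lambda> \<longleftrightarrow> finite \<Lambda> \<and> 0 \<in> \<Lambda> \<and> uminus ` \<Lambda> = \<Lambda>"

definition pairing :: "int ^ 'd \<Rightarrow> real ^ 'd \<Rightarrow> real" where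
  "pairing k \<theta> = (\<Sum>j\<in>UNIV. of_int (k $ j) * \<theta> $ j)"

definition hermitian_on :: "(int ^ 'd) set \<Rightarrow> 'd coeffs \<Rightarrow> bool" where
  "hermitian_on K a \<longleftrightarrow> (\<forall>k\<in>K. a (- k) = cnj (a k))"

definition trig_polys :: "(int ^ 'd) set \<Rightarrow> 'd coeffs set" where
  "trig_polys \<Lambda> = {p. hermitian_on \<Lambda> p \<and> (\<forall>k. k \<notin> \<Lambda> \<longrightarrow> p k = 0)}"

text \<open>
  For Hermitian coefficients the sums below are real, so taking real parts only changes the type;
  see \<open>of_real_trig_eval\<close> and \<open>of_real_coeff_inner\<close>.
\<close>

definition trig_eval :: "(int ^ 'd) set \<Rightarrow> 'd coeffs \<Rightarrow> real ^ 'd \<Rightarrow> real" where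
  "trig_eval \<Lambda> p \<theta> = Re (\<Sum>k\<in>\<Lambda>. p k * cis (- pairing k \<theta>))"

definition coeff_inner :: "(int ^ 'd) set \<Rightarrow> 'd coeffs \<Rightarrow> 'd coeffs \<Rightarrow> real" where
  "coeff_inner \<Lambda> c p = Re (\<Sum>k\<in>\<Lambda>. c k * cnj (p k))"

lemma pairing_minus: "pairing (- k) \<theta> = - pairing k \<theta>"
  by (simp add: pairing_def sum_negf)

lemma sum_real_if_symmetric:
  assumes "index_set \<Lambda>" and "\<And>k. k \<in> \<Lambda> \<Longrightarrow> f (- k) = cnj (f k)"
  shows "complex_of_real (Re (sum f \<Lambda>)) = sum f \<Lambda>"
proof -
  have "sum f \<Lambda> = sum f (uminus ` \<Lambda>)"
    using assms(1) by (simp add: index_set_def)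
  also have "\<dots> = (\<Sum>k\<in>\<Lambda>. f (- k))"
    by (subst sum.reindex) (auto simp: inj_on_def)
  also have "\<dots> = cnj (sum f \<Lambda>)"
    using assms(2) by simp
  finally have "sum f \<Lambda> = cnj (sum f \<Lambda>)" .
  then have "sum f \<Lambda> \<in> \<real>"
    by (simp add: Reals_cnj_iff)
  then show ?thesis
    by (rule of_real_Re)
qed

lemma of_real_trig_eval:
  assumes "index_set \<Lambda>" and "hermitian_on \<Lambda> p"
  shows "complex_of_real (trig_eval \<Lambda> p \<theta>) = (\<Sum>k\<in>\<Lambda>. p k * cis (- pairing k \<theta>))"
  unfolding trig_eval_def
  by (rule sum_real_if_symmetric)
     (use assms in \<open>auto simp: hermitian_on_def pairing_minus cis_cnj\<close>)

lemma of_real_coeff_inner: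
  assumes "index_set \<Lambda>" and "hermitian_on \<Lambda> c" and "hermitian_on \<Lambda> p"
  shows "complex_of_real (coeff_inner \<Lambda> c p) = (\<Sum>k\<in>\<Lambda>. c k * cnj (p k))"
  unfolding coeff_inner_def
  by (rule sum_real_if_symmetric) (use assms in \<open>auto simp: hermitian_on_def\<close>)

definition torus :: "(real ^ 'd) set" where
  "torus = {\<theta>. \<forall>j. - pi < \<theta> $ j \<and> \<theta> $ j \<le> pi}"

text \<open>Integration against the normalised measure \<open>dm\<close>.\<close>

definition torus_integral ::
    "(real ^ 'd \<Rightarrow> 'b::{banach, second_countable_topology}) \<Rightarrow> 'b" where
  "torus_integral f = (1 / (2 * pi)) ^ CARD('d) *\<^sub>R (LINT \<theta>:torus|lborel. f \<theta>)"

definition pos_polys :: "(int ^ 'd) set \<Rightarrow> 'd coeffs set" where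
  "pos_polys \<Lambda> = {p \<in> trig_polys \<Lambda>. \<forall>\<theta>\<in>torus. trig_eval \<Lambda> p \<theta> > 0}"

definition pos_polys_normalized :: "(int ^ 'd) set \<Rightarrow> 'd coeffs set" where
  "pos_polys_normalized \<Lambda> = {p \<in> pos_polys \<Lambda>. p 0 = 1}"

text \<open>
  The closure is taken in the product topology on functions; all elements of \<open>pos_polys \<Lambda>\<close> vanish
  off the finite set \<open>\<Lambda>\<close>, so this is the closure in the finite-dimensional coefficient space.
\<close>

definition pos_dual :: "(int ^ 'd) set \<Rightarrow> 'd coeffs set" where
  "pos_dual \<Lambda> = {c. hermitian_on \<Lambda> c \<and>
     (\<forall>p \<in> closure (pos_polys \<Lambda>) - {\<lambda>_. 0}. coeff_inner \<Lambda> c p > 0)}"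

definition feasible :: "(int ^ 'd) set \<Rightarrow> ('d coeffs \<times> 'd coeffs) set" where
  "feasible \<Lambda> = pos_polys_normalized \<Lambda> \<times> pos_polys \<Lambda>"

definition objective ::
    "(int ^ 'd) set \<Rightarrow> 'd coeffs \<Rightarrow> 'd coeffs \<Rightarrow> real \<Rightarrow> 'd coeffs \<times> 'd coeffs \<Rightarrow> real" where
  "objective \<Lambda> c \<gamma> lam = (\<lambda>(p, q).
     coeff_inner \<Lambda> c q - coeff_inner \<Lambda> \<gamma> p
     + torus_integral (\<lambda>\<theta>. trig_eval \<Lambda> p \<theta> * ln (trig_eval \<Lambda> p \<theta> / trig_eval \<Lambda> q \<theta>))
     - lam * torus_integral (\<lambda>\<theta>. ln (trig_eval \<Lambda> p \<theta>)))"

text \<open>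
  Convexity is spelled out because function types carry no \<open>real_vector\<close> instance.
\<close>

definition convex_comb ::
    "real \<Rightarrow> 'd coeffs \<times> 'd coeffs \<Rightarrow> 'd coeffs \<times> 'd coeffs \<Rightarrow> 'd coeffs \<times> 'd coeffs" where
  "convex_comb t x y =
     ((\<lambda>k. (1 - t) *\<^sub>R fst x k + t *\<^sub>R fst y k), (\<lambda>k. (1 - t) *\<^sub>R snd x k + t *\<^sub>R snd y k))"

definition strictly_convex_problem ::
    "('d coeffs \<times> 'd coeffs) set \<Rightarrow> ('d coeffs \<times> 'd coeffs \<Rightarrow> real) \<Rightarrow> bool" where
  "strictly_convex_problem F J \<longleftrightarrow>
     (\<forall>x\<in>F. \<forall>y\<in>F. \<forall>t. 0 < t \<and> t < 1 \<longrightarrow>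
        convex_comb t x y \<in> F \<and>
        (x \<noteq> y \<longrightarrow> J (convex_comb t x y) < (1 - t) * J x + t * J y))"

end

theory Submission
  imports Defs
begin

text \<open>
  A trigonometric polynomial that is positive on the torus is positive on the whole space, so all
  integrands are continuous and the directional derivative \<open>grad\<close> of the objective depends continuously
  on the point. Integrating a pointwise Bregman inequality shows that the objective lies above its
  tangents, strictly away from the point of tangency; this gives strict convexity and uniqueness.

  For existence, coercivity yields a minimising sequence converging to some \<open>(p', q')\<close> in the closure.
  Write \<open>Pt = (1 - t) P' + t\<close> and \<open>Qt = (1 - t) Q' + t\<close>. By convexity the derivative at \<open>(Pt, Qt)\<close> in the
  direction \<open>(1, 1) - (P', Q')\<close> is nonnegative for all small \<open>t > 0\<close>. It is, however, at most a constant
  minus half the integral of \<open>Pt / Qt + lam / Pt\<close>, so both terms have bounded integrals as \<open>t \<rightarrow> 0\<close>. In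
  dimension at most two the reciprocal of a nonnegative trigonometric polynomial with a zero is not
  integrable; hence first \<open>P'\<close> and then \<open>Q'\<close> has no zero. The minimiser is therefore interior, and the
  moment equations are its stationarity conditions in the directions of single harmonics.
\<close>

text \<open>The obstacle is the boundary of the cone, where the logarithms and quotients in the
  objective become singular. Neither continuity nor differentiability of the objective is available
  at the limit of a minimising sequence, so comparisons are first made at interior points, and only
  the resulting inequalities are passed to the limit. The dimension enters through one count: a
  nonnegative smooth function vanishes to at least second order at a zero, so its reciprocal is at
  least of order \<open>1 / r ^ 2\<close> at distance \<open>r\<close>, while a box of that size has
  volume of order \<open>r ^ d\<close>. \<open>P'\<close> is treated before \<open>Q'\<close>
  because \<open>lam / Pt\<close> involves \<open>P'\<close> alone, whereas \<open>Pt / Qt\<close>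
  controls \<open>1 / Qt\<close> only once \<open>P'\<close> is bounded away from zero: common zeros
  could cancel in the quotient. The direction \<open>(1, 1) - (P', Q')\<close> respects the
  normalisation, since its first component has zeroth coefficient 0.\<close>

subsection \<open>The normalised integral over the torus\<close>

lemma torus_subset_cbox: "(torus :: (real ^ 'd) set) \<subseteq> cbox (vec (- pi)) (vec pi)"
  by (auto simp: torus_def mem_box_cart less_imp_le)

lemma box_subset_torus: "box (vec (- pi)) (vec pi) \<subseteq> (torus :: (real ^ 'd) set)"
  by (auto simp: torus_def mem_box_cart less_imp_le)

lemma sets_torus [measurable]: "(torus :: (real ^ 'd) set) \<in> sets borel"
proof -
  have *: "(torus :: (real ^ 'd) set) = (\<Inter>j. {\<theta>. \<theta> $ j > - pi} \<inter> {\<theta>. \<theta> $ j \<le> pi})"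
    by (auto simp: torus_def)
  show ?thesis
    unfolding *
    by (intro sets.finite_INT sets.Int borel_open borel_closed open_halfspace_component_gt_cart
          closed_halfspace_component_le_cart) auto
qed

text \<open>The half-open torus and the closed cube differ at most on the frontier of the cube. This
  makes facts about compact cubes applicable to integrals over the torus.\<close>

lemma AE_torus_iff_cbox:
  "AE \<theta> in lborel. \<theta> \<in> (torus :: (real ^ 'd) set) \<longleftrightarrow> \<theta> \<in> cbox (vec (- pi)) (vec pi)"
proof (rule AE_I')
  show "cbox (vec (- pi)) (vec pi) - box (vec (- pi)) (vec pi :: real ^ 'd) \<in> null_sets lborel"
    using negligible_frontier_interval[of "vec (- pi) :: real ^ 'd" "vec pi"]
    by (simp add: negligible_iff_null_sets null_sets_completion_iff)
qed (use torus_subset_cbox box_subset_torus in blast)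

lemma set_integrable_torus:
  fixes f :: "real ^ 'd \<Rightarrow> 'b :: {banach, second_countable_topology}"
  assumes "continuous_on UNIV f"
  shows "set_integrable lborel torus f"
proof (rule set_integrable_subset)
  show "set_integrable lborel (cbox (vec (- pi)) (vec pi)) f"
    unfolding set_integrable_def
    by (intro borel_integrable_compact compact_cbox continuous_on_subset[OF assms]) auto
qed (auto simp: torus_subset_cbox)

lemma set_integral_torus_eq_integral:
  fixes f :: "real ^ 'd \<Rightarrow> 'b :: euclidean_space"
  assumes "continuous_on UNIV f"
  shows "(LINT \<theta>:torus|lborel. f \<theta>) = integral (cbox (vec (- pi)) (vec pi)) f"
proof -
  have int: "set_integrable lborel (cbox (vec (- pi)) (vec pi)) f"
    unfolding set_integrable_def
    by (intro borel_integrable_compact compact_cbox continuous_on_subset[OF assms]) auto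
  have "(LINT \<theta>:torus|lborel. f \<theta>) = (LINT \<theta>:cbox (vec (- pi)) (vec pi)|lborel. f \<theta>)"
    using AE_torus_iff_cbox int set_integrable_torus[OF assms]
    by (intro set_integral_cong_set) (auto simp: set_borel_measurable_def set_integrable_def)
  with set_borel_integral_eq_integral(2)[OF int] show ?thesis
    by simp
qed

lemma torus_integral_add:
  assumes "continuous_on UNIV f" "continuous_on UNIV g"
  shows "torus_integral (\<lambda>\<theta>. f \<theta> + g \<theta>) = torus_integral f + torus_integral g"
  using assms by (simp add: torus_integral_def set_integral_add set_integrable_torus scaleR_add_right)

lemma torus_integral_diff:
  assumes "continuous_on UNIV f" "continuous_on UNIV g"
  shows "torus_integral (\<lambda>\<theta>. f \<theta> - g \<theta>) = torus_integral f - torus_integral g"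
  using assms by (simp add: torus_integral_def set_integral_diff set_integrable_torus scaleR_diff_right)

lemma torus_integral_mult_right:
  fixes a :: "'b :: {real_normed_field, banach, second_countable_topology}"
  shows "torus_integral (\<lambda>\<theta>. a * f \<theta>) = a * torus_integral f"
  by (simp add: torus_integral_def)

lemma torus_integral_sum:
  assumes "finite A" "\<And>i. i \<in> A \<Longrightarrow> continuous_on UNIV (f i)"
  shows "torus_integral (\<lambda>\<theta>. \<Sum>i\<in>A. f i \<theta>) = (\<Sum>i\<in>A. torus_integral (f i))"
  using assms
proof (induction A rule: finite_induct)
  case empty
  show ?case by (simp add: torus_integral_def set_lebesgue_integral_def)
next
  case (insert i A)
  then show ?case by (simp add: torus_integral_add continuous_on_sum)
qed

lemma torus_integral_mono:
  fixes f g :: "real ^ 'd \<Rightarrow> real"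
  assumes "continuous_on UNIV f" "continuous_on UNIV g" "\<And>\<theta>. \<theta> \<in> torus \<Longrightarrow> f \<theta> \<le> g \<theta>"
  shows "torus_integral f \<le> torus_integral g"
  unfolding torus_integral_def real_scaleR_def
  by (intro mult_left_mono set_integral_mono set_integrable_torus assms) auto

lemma torus_integral_Re:
  assumes "continuous_on UNIV f"
  shows "torus_integral (\<lambda>\<theta>. Re (f \<theta>)) = Re (torus_integral f)"
proof -
  have "integrable lborel (\<lambda>\<theta>. indicator torus \<theta> *\<^sub>R f \<theta>)"
    using set_integrable_torus[OF assms] by (simp add: set_integrable_def)
  from integral_Re[OF this] show ?thesis
    by (simp add: torus_integral_def set_lebesgue_integral_def)
qed

text \<open>Turns equality of integrals into pointwise equality in the Bregman argument. The detour
  through the closed cube gives access to the vanishing criterion for nonnegative continuous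
  functions.\<close>

lemma torus_integral_eq_0D:
  fixes f :: "real ^ 'd \<Rightarrow> real"
  assumes "continuous_on UNIV f" "\<And>\<theta>. f \<theta> \<ge> 0" "torus_integral f \<le> 0" "\<theta> \<in> torus"
  shows "f \<theta> = 0"
proof -
  have "0 \<le> integral (cbox (vec (- pi)) (vec pi)) f"
    by (rule integral_nonneg) (auto intro: integrable_continuous continuous_on_subset assms)
  moreover have "(1 / (2 * pi)) ^ CARD('d) > 0"
    by simp
  ultimately have "integral (cbox (vec (- pi)) (vec pi)) f = 0"
    using assms(3) set_integral_torus_eq_integral[OF assms(1)]
    by (simp add: torus_integral_def mult_le_0_iff zero_less_mult_iff flip: not_less)
  moreover have "box (vec (- pi)) (vec pi :: real ^ 'd) \<noteq> {}"
    by (auto simp: set_eq_iff mem_box_cart intro!: exI[of _ 0])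
  ultimately have "\<forall>x\<in>cbox (vec (- pi)) (vec pi). f x = 0"
    using assms by (subst (asm) integral_cbox_eq_0_iff) (auto intro: continuous_on_subset)
  with torus_subset_cbox assms(4) show ?thesis
    by blast
qed

lemma integral_cis_Ioc:
  "(LBINT x:{- pi<..pi}. cis (of_int k * x)) = (if k = 0 then 2 * pi else 0)"
proof -
  have "(LBINT x=ereal (- pi)..ereal pi. cis (of_int k * x)) = (if k = 0 then 2 * pi else 0)"
  proof (cases "k = 0")
    case True
    have "(LBINT x=ereal (- pi)..ereal pi. 1 :: complex) = of_real pi - of_real (- pi)"
      by (rule interval_integral_FTC_finite) (auto intro!: derivative_eq_intros continuous_intros)
    with True show ?thesis
      by simp
  next
    case False
    have *: "((\<lambda>x. cis (of_int k * x) / (\<i> * of_int k)) has_vector_derivative cis (of_int k * x))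
        (at x within S)" for x S
      using False
      by (auto simp: cis_conv_exp has_field_derivative_def field_simps
          intro!: derivative_eq_intros has_vector_derivative_real_field)
    have "(LBINT x=ereal (- pi)..ereal pi. cis (of_int k * x)) =
        cis (of_int k * pi) / (\<i> * of_int k) - cis (of_int k * (- pi)) / (\<i> * of_int k)"
      by (rule interval_integral_FTC_finite) (intro continuous_intros *)+
    \<comment> \<open>The two angles differ by \<open>k\<close> full turns, so the antiderivative
      takes equal values at the endpoints.\<close>
    also have "cis (of_int k * (- pi)) = cis (of_int k * pi)"
      by (auto simp: complex_eq_iff sin_zero_iff_int2)
    finally show ?thesis
      using False by simp
  qed
  then show ?thesis
    by (simp add: interval_integral_Ioc)
qed

text \<open>Orthogonality of the characters. Lebesgue measure is the image of a product measure over
  \<open>Basis\<close>, and both the indicator of the torus and the character factor over the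
  coordinates.\<close>

lemma torus_integral_cis:
  fixes k :: "int ^ 'd"
  shows "torus_integral (\<lambda>\<theta>. cis (pairing k \<theta>)) = (if k = 0 then 1 else 0)"
proof -
  interpret product_sigma_finite "\<lambda>_ :: real ^ 'd. lborel :: real measure"
    by standard
  \<comment> \<open>The product measure is indexed by basis vectors rather than coordinates;
    \<open>axis_index\<close> translates back.\<close>
  define F where "F b x = indicator {- pi<..pi} x *\<^sub>R cis (of_int (k $ axis_index b) * x)"
    for b :: "real ^ 'd" and x :: real
  have basis: "(Basis :: (real ^ 'd) set) = (\<lambda>j. axis j 1) ` UNIV"
    by (auto simp: Basis_vec_def)
  have inj: "inj (\<lambda>j :: 'd. axis j (1 :: real))"
    by (auto simp: inj_def axis_eq_axis)
  have idx: "axis_index (axis j (1 :: real)) = j" for j :: 'd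
    by (rule axis_index_axis)
  have coord: "(\<Sum>b\<in>Basis. x b *\<^sub>R b) $ j = x (axis j 1)" for x and j :: 'd
    unfolding basis by (subst sum.reindex[OF inj]) (simp add: axis_def if_distrib cong: if_cong)
  have eq: "indicator torus (\<Sum>b\<in>Basis. x b *\<^sub>R b) *\<^sub>R cis (pairing k (\<Sum>b\<in>Basis. x b *\<^sub>R b)) =
      (\<Prod>b\<in>Basis. F b (x b))" for x
  proof -
    have "(\<Prod>b\<in>Basis. F b (x b)) = (\<Prod>j\<in>UNIV. F (axis j 1) (x (axis j 1)))"
      unfolding basis by (subst prod.reindex[OF inj]) simp
    also have "\<dots> = (\<Prod>j\<in>UNIV. of_real (indicator {- pi<..pi} (x (axis j 1)))) *
        (\<Prod>j\<in>UNIV. cis (of_int (k $ j) * x (axis j 1)))"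
      by (simp add: F_def idx scaleR_conv_of_real prod.distrib)
    also have "(\<Prod>j\<in>UNIV. cis (of_int (k $ j) * x (axis j 1))) = cis (pairing k (\<Sum>b\<in>Basis. x b *\<^sub>R b))"
      unfolding pairing_def coord by (simp add: cis_conv_exp exp_sum sum_distrib_left)
    also have "(\<Prod>j\<in>UNIV. of_real (indicator {- pi<..pi} (x (axis j 1)))) =
        complex_of_real (indicator torus (\<Sum>b\<in>Basis. x b *\<^sub>R b))"
      unfolding torus_def indicator_def mem_Collect_eq coord by auto
    finally show ?thesis
      by (simp add: scaleR_conv_of_real)
  qed
  have F_int: "integrable lborel (F b)" for b
  proof -
    have "set_integrable lborel {- pi..pi} (\<lambda>x. cis (of_int (k $ axis_index b) * x))"
      unfolding set_integrable_def by (intro borel_integrable_compact continuous_intros) auto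
    then have "set_integrable lborel {- pi<..pi} (\<lambda>x. cis (of_int (k $ axis_index b) * x))"
      by (rule set_integrable_subset) auto
    then show ?thesis
      by (simp add: F_def[abs_def] set_integrable_def)
  qed
  have "(LINT \<theta>:torus|lborel. cis (pairing k \<theta>)) = (\<integral>x. (\<Prod>b\<in>Basis. F b (x b)) \<partial>(\<Pi>\<^sub>M b\<in>Basis. lborel))"
  proof -
    have meas: "(\<lambda>\<theta>. indicator torus \<theta> *\<^sub>R cis (pairing k \<theta>)) \<in> borel_measurable borel"
      unfolding pairing_def by (intro borel_measurable_scaleR borel_measurable_indicator sets_torus
        borel_measurable_continuous_onI continuous_intros)
    show ?thesis
      unfolding set_lebesgue_integral_def
      by (subst lborel_eq, subst integral_distr[OF _ meas], measurable) (simp only: eq)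
  qed
  also have "\<dots> = (\<Prod>b\<in>Basis. integral\<^sup>L lborel (F b))"
    by (rule product_integral_prod) (auto simp: F_int)
  also have "\<dots> = (\<Prod>j\<in>UNIV. integral\<^sup>L lborel (F (axis j 1)))"
    unfolding basis by (subst prod.reindex[OF inj]) simp
  also have "\<dots> = (\<Prod>j\<in>UNIV. if k $ j = 0 then 2 * pi else 0)"
    using integral_cis_Ioc by (simp add: F_def[abs_def] idx set_lebesgue_integral_def)
  also have "\<dots> = (if k = 0 then (2 * pi) ^ CARD('d) else 0)"
    by (auto simp: vec_eq_iff)
  finally show ?thesis
    by (auto simp: torus_integral_def scaleR_conv_of_real power_divide)
qed

lemma torus_integral_const [simp]:
  fixes a :: real
  shows "torus_integral (\<lambda>_ :: real ^ 'd. a) = a"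
proof -
  have "torus_integral (\<lambda>_ :: real ^ 'd. 1 :: real) = Re (torus_integral (\<lambda>\<theta> :: real ^ 'd. cis (pairing 0 \<theta>)))"
    by (subst torus_integral_Re[symmetric]) (simp_all add: pairing_def)
  then have "torus_integral (\<lambda>_ :: real ^ 'd. 1 :: real) = 1"
    by (simp add: torus_integral_cis)
  with torus_integral_mult_right[of a "\<lambda>_ :: real ^ 'd. 1"] show ?thesis
    by simp
qed

subsection \<open>Trigonometric polynomials\<close>

lemma continuous_on_pairing [continuous_intros]: "continuous_on S (pairing k)"
  unfolding pairing_def by (intro continuous_intros)

lemma continuous_on_trig_eval [continuous_intros]: "continuous_on S (trig_eval \<Lambda> p)"
  unfolding trig_eval_def by (intro continuous_intros)

lemma trig_eval_lincomb:
  "trig_eval \<Lambda> (\<lambda>k. a *\<^sub>R p k + b *\<^sub>R q k) \<theta> = a * trig_eval \<Lambda> p \<theta> + b * trig_eval \<Lambda> q \<theta>"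
  by (simp add: trig_eval_def algebra_simps sum.distrib sum_distrib_left)

lemma trig_eval_diff:
  "trig_eval \<Lambda> (\<lambda>k. p k - q k) \<theta> = trig_eval \<Lambda> p \<theta> - trig_eval \<Lambda> q \<theta>"
  using trig_eval_lincomb[of \<Lambda> 1 p "-1" q] by simp

lemma coeff_inner_lincomb:
  "coeff_inner \<Lambda> c (\<lambda>k. a *\<^sub>R p k + b *\<^sub>R q k) = a * coeff_inner \<Lambda> c p + b * coeff_inner \<Lambda> c q"
  by (simp add: coeff_inner_def algebra_simps sum.distrib sum_distrib_left)

lemma coeff_inner_diff:
  "coeff_inner \<Lambda> c (\<lambda>k. p k - q k) = coeff_inner \<Lambda> c p - coeff_inner \<Lambda> c q"
  using coeff_inner_lincomb[of \<Lambda> c 1 p "-1" q] by simp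

lemma trig_polys_lincomb:
  assumes "p \<in> trig_polys \<Lambda>" "q \<in> trig_polys \<Lambda>"
  shows "(\<lambda>k. a *\<^sub>R p k + b *\<^sub>R q k) \<in> trig_polys \<Lambda>"
  using assms by (auto simp: trig_polys_def hermitian_on_def)

lemma abs_trig_eval_le: "\<bar>trig_eval \<Lambda> p \<theta>\<bar> \<le> (\<Sum>k\<in>\<Lambda>. norm (p k))"
proof -
  have "\<bar>trig_eval \<Lambda> p \<theta>\<bar> \<le> norm (\<Sum>k\<in>\<Lambda>. p k * cis (- pairing k \<theta>))"
    unfolding trig_eval_def by (rule abs_Re_le_cmod)
  also have "\<dots> \<le> (\<Sum>k\<in>\<Lambda>. norm (p k * cis (- pairing k \<theta>)))"
    by (rule norm_sum)
  finally show ?thesis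
    by (simp add: norm_mult)
qed

text \<open>Frequencies are integral, so shifting coordinates by multiples of 2 pi changes no value.
  This carries pointwise facts from the torus to the whole space.\<close>

lemma trig_eval_torus_representative:
  obtains \<eta> where "\<eta> \<in> torus" "\<And>\<Lambda> p. trig_eval \<Lambda> p \<eta> = trig_eval \<Lambda> p \<theta>"
proof
  \<comment> \<open>The ceiling, not the floor, matches an interval open at \<open>- pi\<close> and
    closed at \<open>pi\<close>.\<close>
  define n where "n j = \<lceil>(\<theta> $ j - pi) / (2 * pi)\<rceil>" for j
  define \<eta> where "\<eta> = (\<chi> j. \<theta> $ j - 2 * pi * of_int (n j))"
  show "\<eta> \<in> torus"
    unfolding torus_def
  proof (intro CollectI allI)
    fix j
    have "(\<theta> $ j - pi) / (2 * pi) \<le> of_int (n j)" "of_int (n j) < (\<theta> $ j - pi) / (2 * pi) + 1"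
      unfolding n_def by linarith+
    then show "- pi < \<eta> $ j \<and> \<eta> $ j \<le> pi"
      by (simp add: \<eta>_def field_simps)
  qed
  have "cis (- pairing k \<eta>) = cis (- pairing k \<theta>)" for k
  proof -
    have "- pairing k \<eta> = - pairing k \<theta> + 2 * pi * of_int (\<Sum>j\<in>UNIV. k $ j * n j)"
      by (simp add: pairing_def \<eta>_def algebra_simps sum_subtractf sum_distrib_left)
    then show ?thesis
      by (simp only: cis_mult[symmetric] cis_multiple_2pi[OF Ints_of_int] mult_1_right)
  qed
  then show "trig_eval \<Lambda> p \<eta> = trig_eval \<Lambda> p \<theta>" for \<Lambda> p
    by (simp add: trig_eval_def)
qed

lemma pos_polysD:
  assumes "p \<in> pos_polys \<Lambda>"
  shows "p \<in> trig_polys \<Lambda>" "trig_eval \<Lambda> p \<theta> > 0"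
proof -
  show "p \<in> trig_polys \<Lambda>"
    using assms by (simp add: pos_polys_def)
  obtain \<eta> where "\<eta> \<in> torus" "trig_eval \<Lambda> p \<eta> = trig_eval \<Lambda> p \<theta>"
    by (metis trig_eval_torus_representative)
  with assms show "trig_eval \<Lambda> p \<theta> > 0"
    by (simp add: pos_polys_def) metis
qed

text \<open>The torus is not closed, so the minimum is taken over the closed cube; positivity on the
  whole space makes it positive, and periodicity makes it global.\<close>

lemma pos_polys_lower_bound:
  fixes p :: "int ^ 'd \<Rightarrow> complex"
  assumes "p \<in> pos_polys \<Lambda>"
  obtains m where "m > 0" "\<And>\<theta>. m \<le> trig_eval \<Lambda> p \<theta>"
proof -
  have "cbox (vec (- pi)) (vec pi :: real ^ 'd) \<noteq> {}"
    by (auto simp: set_eq_iff mem_box_cart intro!: exI[of _ 0])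
  then obtain x where x: "\<And>y. y \<in> cbox (vec (- pi)) (vec pi) \<Longrightarrow> trig_eval \<Lambda> p x \<le> trig_eval \<Lambda> p y"
    using continuous_attains_inf[OF compact_cbox _ continuous_on_trig_eval] by metis
  show thesis
  proof
    show "trig_eval \<Lambda> p x > 0"
      by (rule pos_polysD[OF assms])
    show "trig_eval \<Lambda> p x \<le> trig_eval \<Lambda> p \<theta>" for \<theta>
      by (metis x torus_subset_cbox subsetD trig_eval_torus_representative)
  qed
qed

text \<open>Polynomials are expanded in \<open>cis (- pairing j \<theta>)\<close>, so the character
  extracting a coefficient carries the opposite sign.\<close>

lemma fourier_coeff:
  assumes "index_set \<Lambda>" "p \<in> trig_polys \<Lambda>"
  shows "torus_integral (\<lambda>\<theta>. cis (pairing k \<theta>) * of_real (trig_eval \<Lambda> p \<theta>)) = p k"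
proof -
  have fin: "finite \<Lambda>"
    using assms(1) by (simp add: index_set_def)
  have "cis (pairing k \<theta>) * of_real (trig_eval \<Lambda> p \<theta>) = (\<Sum>j\<in>\<Lambda>. p j * cis (pairing (k - j) \<theta>))" for \<theta>
  proof -
    have "cis (pairing k \<theta>) * of_real (trig_eval \<Lambda> p \<theta>) =
        (\<Sum>j\<in>\<Lambda>. p j * (cis (pairing k \<theta>) * cis (- pairing j \<theta>)))"
      using assms by (subst of_real_trig_eval) (auto simp: trig_polys_def sum_distrib_left mult_ac)
    also have "\<dots> = (\<Sum>j\<in>\<Lambda>. p j * cis (pairing (k - j) \<theta>))"
      by (simp add: cis_mult pairing_def sum_subtractf algebra_simps)
    finally show ?thesis .
  qed
  then have "torus_integral (\<lambda>\<theta>. cis (pairing k \<theta>) * of_real (trig_eval \<Lambda> p \<theta>)) =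
      (\<Sum>j\<in>\<Lambda>. p j * (if k - j = 0 then 1 else 0))"
    using fin by (simp add: torus_integral_sum continuous_intros torus_integral_mult_right torus_integral_cis)
  also have "\<dots> = p k"
    using fin assms(2) by (simp add: trig_polys_def sum.delta if_distrib eq_commute[of k] cong: if_cong)
  finally show ?thesis .
qed

lemma torus_integral_trig_eval:
  assumes "index_set \<Lambda>" "p \<in> trig_polys \<Lambda>"
  shows "torus_integral (trig_eval \<Lambda> p) = Re (p 0)"
proof -
  have "Re (p 0) = torus_integral (\<lambda>\<theta>. Re (cis (pairing 0 \<theta>) * of_real (trig_eval \<Lambda> p \<theta>)))"
    using fourier_coeff[OF assms, of 0]
    by (subst torus_integral_Re) (auto intro!: continuous_intros)
  then show ?thesis
    by (simp add: pairing_def)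
qed

lemma trig_polys_eqI:
  assumes "index_set \<Lambda>" "p \<in> trig_polys \<Lambda>" "q \<in> trig_polys \<Lambda>"
    and "\<And>\<theta>. \<theta> \<in> torus \<Longrightarrow> trig_eval \<Lambda> p \<theta> = trig_eval \<Lambda> q \<theta>"
  shows "p = q"
proof
  fix k
  have "trig_eval \<Lambda> p \<theta> = trig_eval \<Lambda> q \<theta>" for \<theta>
    by (metis assms(4) trig_eval_torus_representative)
  then show "p k = q k"
    using fourier_coeff[OF assms(1,2), of k] fourier_coeff[OF assms(1,3), of k] by simp
qed

lemma trig_polys_coeff_0:
  assumes "index_set \<Lambda>" "p \<in> trig_polys \<Lambda>"
  shows "p 0 = of_real (Re (p 0))"
proof -
  have "p 0 = cnj (p 0)"
    using assms by (force simp: index_set_def trig_polys_def hermitian_on_def)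
  then show ?thesis
    by (simp add: complex_eq_iff)
qed

text \<open>A coefficient is the integral of a unimodular multiple of a positive function with
  integral \<open>Re (p 0)\<close>. Control of the zeroth coefficient therefore gives
  compactness.\<close>

lemma pos_polys_norm_le:
  assumes "index_set \<Lambda>" "p \<in> pos_polys \<Lambda>"
  shows "norm (p k) \<le> Re (p 0)"
proof -
  note p = pos_polysD[OF assms(2)]
  \<comment> \<open>Rotating by the phase \<open>z\<close> turns the modulus into a real part, which
    commutes with the integral.\<close>
  obtain z where z: "norm z = 1" "z * p k = of_real (norm (p k))"
  proof (cases "p k = 0")
    case False
    then show thesis
      by (intro that[of "cnj (p k) / of_real (norm (p k))"])
         (auto simp: norm_divide field_simps complex_norm_square[symmetric] power2_eq_square mult.commute)
  qed (use that[of 1] in auto)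
  have "norm (p k) = Re (z * p k)"
    using z by simp
  also have "\<dots> = torus_integral (\<lambda>\<theta>. Re (z * (cis (pairing k \<theta>) * of_real (trig_eval \<Lambda> p \<theta>))))"
    using fourier_coeff[OF assms(1) p(1), of k]
    by (subst torus_integral_Re) (auto intro!: continuous_intros simp: torus_integral_mult_right)
  also have "\<dots> \<le> torus_integral (trig_eval \<Lambda> p)"
  proof (rule torus_integral_mono)
    fix \<theta>
    have "Re (z * (cis (pairing k \<theta>) * of_real (trig_eval \<Lambda> p \<theta>))) \<le>
        norm (z * (cis (pairing k \<theta>) * of_real (trig_eval \<Lambda> p \<theta>)))"
      by (rule complex_Re_le_cmod)
    also have "\<dots> = trig_eval \<Lambda> p \<theta>"
      using z p(2)[of \<theta>] by (simp add: norm_mult)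
    finally show "Re (z * (cis (pairing k \<theta>) * of_real (trig_eval \<Lambda> p \<theta>))) \<le> trig_eval \<Lambda> p \<theta>" .
  qed (intro continuous_intros)+
  also have "\<dots> = Re (p 0)"
    by (rule torus_integral_trig_eval[OF assms(1) p(1)])
  finally show ?thesis .
qed

lemma pos_polys_lincomb:
  assumes "p \<in> pos_polys \<Lambda>" "q \<in> pos_polys \<Lambda>" "0 \<le> a" "0 \<le> b" "0 < a + b"
  shows "(\<lambda>k. a *\<^sub>R p k + b *\<^sub>R q k) \<in> pos_polys \<Lambda>"
proof -
  have "a * trig_eval \<Lambda> p \<theta> + b * trig_eval \<Lambda> q \<theta> > 0" for \<theta>
    using pos_polysD(2)[OF assms(1), of \<theta>] pos_polysD(2)[OF assms(2), of \<theta>] assms(3-5)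
    by (cases "a = 0") (auto intro: add_pos_nonneg)
  then show ?thesis
    using pos_polysD(1)[OF assms(1)] pos_polysD(1)[OF assms(2)]
    by (simp add: pos_polys_def trig_eval_lincomb trig_polys_lincomb)
qed

text \<open>The constant polynomial 1, the interior point towards which boundary points are
  moved.\<close>

definition unit_coeffs :: "int ^ 'd \<Rightarrow> complex" where
  "unit_coeffs k = (if k = 0 then 1 else 0)"

lemma trig_eval_unit_coeffs [simp]: "index_set \<Lambda> \<Longrightarrow> trig_eval \<Lambda> unit_coeffs \<theta> = 1"
  by (simp add: trig_eval_def unit_coeffs_def index_set_def sum.delta if_distrib[of "\<lambda>x. x * _"] pairing_def
      cong: if_cong)

lemma unit_coeffs_pos: "index_set \<Lambda> \<Longrightarrow> unit_coeffs \<in> pos_polys_normalized \<Lambda>"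
  by (auto simp: pos_polys_normalized_def pos_polys_def trig_polys_def hermitian_on_def)
     (auto simp: unit_coeffs_def index_set_def)

subsection \<open>The objective and its directional derivative\<close>

definition entropy_density :: "real \<Rightarrow> real \<Rightarrow> real \<Rightarrow> real" where
  "entropy_density lam P Q = P * ln (P / Q) - lam * ln P"

text \<open>The derivative in direction \<open>(U, V)\<close>: the partial derivatives are
  \<open>ln (P / Q) + 1 - lam / P\<close> in \<open>P\<close> and \<open>- P / Q\<close> in
  \<open>Q\<close>.\<close>

definition entropy_deriv :: "real \<Rightarrow> real \<Rightarrow> real \<Rightarrow> real \<Rightarrow> real \<Rightarrow> real" where
  "entropy_deriv lam P Q U V = U * (ln (P / Q) + 1) - P / Q * V - lam * (U / P)"

lemma ln_less_minus_1:
  fixes x :: real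
  assumes "x > 0" "x \<noteq> 1"
  shows "ln x < x - 1"
  using ln_le_minus_one[OF assms(1)] ln_eq_minus_one[OF assms(1)] assms(2) by fastforce

text \<open>Both remainders have the form \<open>x - 1 - ln x\<close>, which is nonnegative and
  vanishes only at 1. The first detects only the ratio \<open>P / Q\<close>, because
  \<open>P * ln (P / Q)\<close> is homogeneous of degree one and hence linear along rays; the
  \<open>lam\<close> term then fixes \<open>P\<close> itself.\<close>

lemma entropy_density_bregman:
  assumes "P > 0" "Q > 0" "P' > 0" "Q' > 0"
  shows "entropy_density lam P' Q' - entropy_density lam P Q - entropy_deriv lam P Q (P' - P) (Q' - Q) =
    P' * (P * Q' / (Q * P') - 1 - ln (P * Q' / (Q * P'))) + lam * (P' / P - 1 - ln (P' / P))"
  using assms by (simp add: entropy_density_def entropy_deriv_def ln_div ln_mult field_simps)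

lemma entropy_density_above_tangent:
  assumes "P > 0" "Q > 0" "P' > 0" "Q' > 0" "lam > 0"
  shows "entropy_density lam P' Q' \<ge> entropy_density lam P Q + entropy_deriv lam P Q (P' - P) (Q' - Q)"
    and "entropy_density lam P' Q' = entropy_density lam P Q + entropy_deriv lam P Q (P' - P) (Q' - Q) \<Longrightarrow>
      P' = P \<and> Q' = Q"
proof -
  define a where "a = P * Q' / (Q * P') - 1 - ln (P * Q' / (Q * P'))"
  define b where "b = P' / P - 1 - ln (P' / P)"
  have "a \<ge> 0" "b \<ge> 0"
    unfolding a_def b_def using assms by (smt (verit) ln_le_minus_one divide_pos_pos mult_pos_pos)+
  then have ab: "P' * a \<ge> 0" "lam * b \<ge> 0"
    using assms by auto
  have eq: "entropy_density lam P' Q' - entropy_density lam P Q - entropy_deriv lam P Q (P' - P) (Q' - Q) =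
      P' * a + lam * b"
    unfolding a_def b_def by (rule entropy_density_bregman) (use assms in auto)
  with ab show "entropy_density lam P' Q' \<ge> entropy_density lam P Q + entropy_deriv lam P Q (P' - P) (Q' - Q)"
    by linarith
  assume "entropy_density lam P' Q' = entropy_density lam P Q + entropy_deriv lam P Q (P' - P) (Q' - Q)"
  with eq ab have "P' * a = 0" "lam * b = 0"
    by linarith+
  with assms have "a = 0" "b = 0"
    by auto
  then have "P' / P = 1" "P * Q' / (Q * P') = 1"
    unfolding a_def b_def using assms ln_less_minus_1[of "P' / P"] ln_less_minus_1[of "P * Q' / (Q * P')"]
    by fastforce+
  with assms show "P' = P \<and> Q' = Q"
    by (simp add: field_simps)
qed

lemma continuous_on_entropy [continuous_intros]:
  fixes P Q U V :: "'a :: topological_space \<Rightarrow> real"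
  assumes "continuous_on S P" "continuous_on S Q" "\<And>x. x \<in> S \<Longrightarrow> P x > 0" "\<And>x. x \<in> S \<Longrightarrow> Q x > 0"
  shows "continuous_on S (\<lambda>x. entropy_density lam (P x) (Q x))"
    and "continuous_on S U \<Longrightarrow> continuous_on S V \<Longrightarrow>
      continuous_on S (\<lambda>x. entropy_deriv lam (P x) (Q x) (U x) (V x))"
  unfolding entropy_density_def entropy_deriv_def using assms
  by (auto intro!: continuous_intros simp: less_imp_neq[symmetric])

lemma entropy_deriv_lincomb:
  "entropy_deriv lam P Q (a * U + b * U') (a * V + b * V') =
    a * entropy_deriv lam P Q U V + b * entropy_deriv lam P Q U' V'"
  by (simp add: entropy_deriv_def algebra_simps add_divide_distrib)

lemma tendsto_torus_integral_dominated:
  fixes f :: "real ^ 'd \<Rightarrow> real"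
  assumes "\<And>n. continuous_on UNIV (F n)" "continuous_on UNIV f"
    and "\<And>\<theta>. (\<lambda>n. F n \<theta>) \<longlonglongrightarrow> f \<theta>" "\<And>n \<theta>. \<bar>F n \<theta>\<bar> \<le> B"
  shows "(\<lambda>n. torus_integral (F n)) \<longlonglongrightarrow> torus_integral f"
proof -
  have meas: "(\<lambda>\<theta>. indicator torus \<theta> *\<^sub>R g \<theta>) \<in> borel_measurable lborel"
    if "continuous_on UNIV g" for g :: "real ^ 'd \<Rightarrow> real"
    using set_integrable_torus[OF that] by (auto simp: set_integrable_def)
  have "(\<lambda>n. LINT \<theta>:torus|lborel. F n \<theta>) \<longlonglongrightarrow> (LINT \<theta>:torus|lborel. f \<theta>)"
    unfolding set_lebesgue_integral_def
  proof (rule integral_dominated_convergence)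
    show "integrable lborel (\<lambda>\<theta> :: real ^ 'd. indicator torus \<theta> *\<^sub>R B)"
      using set_integrable_torus[of "\<lambda>_ :: real ^ 'd. B"] by (simp add: set_integrable_def)
    show "AE \<theta> in lborel. (\<lambda>n. indicat_real torus \<theta> *\<^sub>R F n \<theta>) \<longlonglongrightarrow> indicat_real torus \<theta> *\<^sub>R f \<theta>"
      using assms(3) by (auto intro!: always_eventually tendsto_intros)
    show "AE \<theta> in lborel. norm (indicat_real torus \<theta> *\<^sub>R F n \<theta>) \<le> indicat_real torus \<theta> *\<^sub>R B" for n
      using assms(4) by (auto intro!: always_eventually simp: indicator_def)
  qed ((rule meas, rule assms)+)
  then show ?thesis
    unfolding torus_integral_def by (intro tendsto_intros)
qed

text \<open>Provides the dominating constant for limits under the integral. Bounding both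
  \<open>P / Q\<close> and \<open>Q / P\<close> by \<open>M / m\<close> controls the logarithm from
  both sides.\<close>

lemma abs_entropy_deriv_le:
  assumes "0 < m" "m \<le> P" "P \<le> M" "m \<le> Q" "Q \<le> M" "\<bar>U\<bar> \<le> M" "\<bar>V\<bar> \<le> M"
  shows "\<bar>entropy_deriv lam P Q U V\<bar> \<le> M * (ln (M / m) + 1) + M / m * M + \<bar>lam\<bar> * (M / m)"
proof -
  have pos: "P > 0" "Q > 0" "M > 0"
    using assms by linarith+
  have "ln (P / Q) \<le> ln (M / m)"
    using assms pos by (subst ln_le_cancel_iff) (auto intro!: frac_le)
  moreover have "ln (Q / P) \<le> ln (M / m)"
    using assms pos by (subst ln_le_cancel_iff) (auto intro!: frac_le)
  ultimately have "\<bar>ln (P / Q) + 1\<bar> \<le> ln (M / m) + 1"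
    using pos by (simp add: ln_div)
  then have 1: "\<bar>U * (ln (P / Q) + 1)\<bar> \<le> M * (ln (M / m) + 1)"
    using assms pos by (simp add: abs_mult mult_mono)
  have 2: "\<bar>P / Q * V\<bar> \<le> M / m * M"
    using assms pos by (auto simp: abs_mult intro!: mult_mono frac_le)
  have "\<bar>U / P\<bar> \<le> M / m"
    using assms pos by (auto intro!: frac_le)
  then have 3: "\<bar>lam * (U / P)\<bar> \<le> \<bar>lam\<bar> * (M / m)"
    by (simp only: abs_mult) (rule mult_left_mono, auto)
  from 1 2 3 show ?thesis
    unfolding entropy_deriv_def by linarith
qed

locale cepstral_problem =
  fixes \<Lambda> :: "(int ^ 'd) set" and c \<gamma> :: "int ^ 'd \<Rightarrow> complex" and lam :: real
  assumes index_set: "index_set \<Lambda>" and gamma_hermitian: "hermitian_on (\<Lambda> - {0}) \<gamma>"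
    and c_dual: "c \<in> pos_dual \<Lambda>" and lam_pos: "lam > 0"
begin

abbreviation ev where "ev \<equiv> trig_eval \<Lambda>"

abbreviation J where "J \<equiv> objective \<Lambda> c \<gamma> lam"

lemma finite_index: "finite \<Lambda>"
  using index_set by (simp add: index_set_def)

text \<open>The directional derivative of \<open>J\<close> at \<open>(p, q)\<close> along
  \<open>(u, v)\<close>, introduced by its formula. Differentiability of \<open>J\<close> is never
  proved: the tangent inequality and the continuity of \<open>grad\<close> take its place.\<close>

definition grad where
  "grad p q u v = coeff_inner \<Lambda> c v - coeff_inner \<Lambda> \<gamma> u
     + torus_integral (\<lambda>\<theta>. entropy_deriv lam (ev p \<theta>) (ev q \<theta>) (ev u \<theta>) (ev v \<theta>))"

lemma objective_eq:
  assumes "p \<in> pos_polys \<Lambda>" "q \<in> pos_polys \<Lambda>"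
  shows "J (p, q) = coeff_inner \<Lambda> c q - coeff_inner \<Lambda> \<gamma> p
    + torus_integral (\<lambda>\<theta>. entropy_density lam (ev p \<theta>) (ev q \<theta>))"
proof -
  note pos = pos_polysD(2)[OF assms(1)] pos_polysD(2)[OF assms(2)]
  have "torus_integral (\<lambda>\<theta>. entropy_density lam (ev p \<theta>) (ev q \<theta>)) =
      torus_integral (\<lambda>\<theta>. ev p \<theta> * ln (ev p \<theta> / ev q \<theta>)) - torus_integral (\<lambda>\<theta>. lam * ln (ev p \<theta>))"
    unfolding entropy_density_def using pos
    by (intro torus_integral_diff continuous_intros) (auto simp: less_imp_neq[symmetric])
  then show ?thesis
    by (simp add: objective_def torus_integral_mult_right)
qed

lemma grad_lincomb:
  assumes "p \<in> pos_polys \<Lambda>" "q \<in> pos_polys \<Lambda>"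
  shows "grad p q (\<lambda>k. a *\<^sub>R u k + b *\<^sub>R u' k) (\<lambda>k. a *\<^sub>R v k + b *\<^sub>R v' k) =
    a * grad p q u v + b * grad p q u' v'"
proof -
  have cont: "continuous_on UNIV (\<lambda>\<theta>. entropy_deriv lam (ev p \<theta>) (ev q \<theta>) (ev u \<theta>) (ev v \<theta>))" for u v
    by (intro continuous_intros pos_polysD assms)
  have "torus_integral (\<lambda>\<theta>. entropy_deriv lam (ev p \<theta>) (ev q \<theta>)
        (ev (\<lambda>k. a *\<^sub>R u k + b *\<^sub>R u' k) \<theta>) (ev (\<lambda>k. a *\<^sub>R v k + b *\<^sub>R v' k) \<theta>)) =
      torus_integral (\<lambda>\<theta>. a * entropy_deriv lam (ev p \<theta>) (ev q \<theta>) (ev u \<theta>) (ev v \<theta>)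
        + b * entropy_deriv lam (ev p \<theta>) (ev q \<theta>) (ev u' \<theta>) (ev v' \<theta>))"
    by (simp add: trig_eval_lincomb entropy_deriv_lincomb)
  also have "\<dots> = a * torus_integral (\<lambda>\<theta>. entropy_deriv lam (ev p \<theta>) (ev q \<theta>) (ev u \<theta>) (ev v \<theta>))
      + b * torus_integral (\<lambda>\<theta>. entropy_deriv lam (ev p \<theta>) (ev q \<theta>) (ev u' \<theta>) (ev v' \<theta>))"
    by (subst torus_integral_add) (auto intro!: continuous_intros cont simp: torus_integral_mult_right)
  finally show ?thesis
    unfolding grad_def coeff_inner_lincomb by (simp add: algebra_simps)
qed

text \<open>In the equality case the continuous nonnegative remainder \<open>R\<close> has zero
  integral, so it vanishes on the torus; the values of the polynomials then agree there, and values
  determine coefficients.\<close>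

lemma objective_above_tangent:
  assumes "p \<in> pos_polys \<Lambda>" "q \<in> pos_polys \<Lambda>" "p' \<in> pos_polys \<Lambda>" "q' \<in> pos_polys \<Lambda>"
  shows "J (p', q') \<ge> J (p, q) + grad p q (\<lambda>k. p' k - p k) (\<lambda>k. q' k - q k)" (is ?ge)
    and "J (p', q') = J (p, q) + grad p q (\<lambda>k. p' k - p k) (\<lambda>k. q' k - q k) \<Longrightarrow> p' = p \<and> q' = q"
proof -
  note pos = pos_polysD(2)[OF assms(1)] pos_polysD(2)[OF assms(2)]
    pos_polysD(2)[OF assms(3)] pos_polysD(2)[OF assms(4)]
  define E where "E \<theta> = entropy_density lam (ev p \<theta>) (ev q \<theta>)" for \<theta>
  define E' where "E' \<theta> = entropy_density lam (ev p' \<theta>) (ev q' \<theta>)" for \<theta>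
  define D where "D \<theta> = entropy_deriv lam (ev p \<theta>) (ev q \<theta>) (ev p' \<theta> - ev p \<theta>) (ev q' \<theta> - ev q \<theta>)" for \<theta>
  define R where "R \<theta> = E' \<theta> - (E \<theta> + D \<theta>)" for \<theta>
  have cont: "continuous_on UNIV E" "continuous_on UNIV E'" "continuous_on UNIV D"
    unfolding E_def E'_def D_def by (intro continuous_intros pos)+
  have nonneg: "R \<theta> \<ge> 0" for \<theta>
    using entropy_density_above_tangent(1)[OF pos lam_pos, of \<theta> \<theta> \<theta> \<theta>] by (simp add: R_def E_def E'_def D_def)
  have "torus_integral R = torus_integral E' - (torus_integral E + torus_integral D)"
    unfolding R_def using cont by (simp add: torus_integral_diff torus_integral_add continuous_on_add)
  then have eq: "J (p', q') - (J (p, q) + grad p q (\<lambda>k. p' k - p k) (\<lambda>k. q' k - q k)) = torus_integral R"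
    unfolding objective_eq[OF assms(1,2)] objective_eq[OF assms(3,4)] grad_def trig_eval_diff coeff_inner_diff
      E_def[symmetric] E'_def[symmetric] D_def[symmetric] by simp
  have cont_R: "continuous_on UNIV R"
    unfolding R_def using cont by (intro continuous_intros)
  have "torus_integral R \<ge> torus_integral (\<lambda>_ :: real ^ 'd. 0 :: real)"
    by (intro torus_integral_mono nonneg cont_R continuous_intros)
  with eq show ?ge
    by simp
  assume "J (p', q') = J (p, q) + grad p q (\<lambda>k. p' k - p k) (\<lambda>k. q' k - q k)"
  with eq have "R \<theta> = 0" if "\<theta> \<in> torus" for \<theta>
    using that by (intro torus_integral_eq_0D[OF cont_R nonneg]) auto
  then have "ev p' \<theta> = ev p \<theta> \<and> ev q' \<theta> = ev q \<theta>" if "\<theta> \<in> torus" for \<theta>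
    using that by (intro entropy_density_above_tangent(2)[OF pos lam_pos])
      (simp add: R_def E_def E'_def D_def)
  then show "p' = p \<and> q' = q"
    using assms by (auto intro!: trig_polys_eqI[OF index_set] pos_polysD)
qed

section \<open>Continuity of the directional derivative\<close>

lemma tendsto_trig_eval:
  assumes "\<And>k. k \<in> \<Lambda> \<Longrightarrow> (\<lambda>n. p n k) \<longlonglongrightarrow> p' k"
  shows "(\<lambda>n. ev (p n) \<theta>) \<longlonglongrightarrow> ev p' \<theta>"
  unfolding trig_eval_def by (intro tendsto_intros assms)

lemma tendsto_coeff_inner:
  assumes "\<And>k. k \<in> \<Lambda> \<Longrightarrow> (\<lambda>n. p n k) \<longlonglongrightarrow> p' k"
  shows "(\<lambda>n. coeff_inner \<Lambda> a (p n)) \<longlonglongrightarrow> coeff_inner \<Lambda> a p'"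
  unfolding coeff_inner_def by (intro tendsto_intros assms)

lemma trig_eval_bounded_of_convergent:
  assumes "\<And>k. k \<in> \<Lambda> \<Longrightarrow> (\<lambda>n. p n k) \<longlonglongrightarrow> p' k"
  obtains M where "\<And>n \<theta>. \<bar>ev (p n) \<theta>\<bar> \<le> M"
proof -
  have "convergent (\<lambda>n. \<Sum>k\<in>\<Lambda>. norm (p n k))"
    by (rule convergentI[where L = "\<Sum>k\<in>\<Lambda>. norm (p' k)"]) (intro tendsto_intros assms)
  then have "Bseq (\<lambda>n. \<Sum>k\<in>\<Lambda>. norm (p n k))"
    by (rule convergent_imp_Bseq)
  then obtain M where M: "\<And>n. norm (\<Sum>k\<in>\<Lambda>. norm (p n k)) \<le> M"
    by (auto simp: Bseq_def)
  have "\<bar>ev (p n) \<theta>\<bar> \<le> M" for n \<theta>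
    using abs_trig_eval_le[of \<Lambda> "p n" \<theta>] M[of n] by simp
  with that show thesis .
qed

text \<open>The common lower bound \<open>m\<close> keeps all arguments away from the singularities
  and so yields a constant dominating function. The directions may vary as well, because the
  direction towards the constant 1 depends on the starting point.\<close>

lemma tendsto_grad:
  assumes lim: "\<And>k. k \<in> \<Lambda> \<Longrightarrow> (\<lambda>n. p n k) \<longlonglongrightarrow> p' k" "\<And>k. k \<in> \<Lambda> \<Longrightarrow> (\<lambda>n. q n k) \<longlonglongrightarrow> q' k"
    "\<And>k. k \<in> \<Lambda> \<Longrightarrow> (\<lambda>n. u n k) \<longlonglongrightarrow> u' k" "\<And>k. k \<in> \<Lambda> \<Longrightarrow> (\<lambda>n. v n k) \<longlonglongrightarrow> v' k"
    and m: "m > 0" "\<And>n \<theta>. m \<le> ev (p n) \<theta>" "\<And>n \<theta>. m \<le> ev (q n) \<theta>"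
  shows "(\<lambda>n. grad (p n) (q n) (u n) (v n)) \<longlonglongrightarrow> grad p' q' u' v'"
proof -
  obtain M1 M2 M3 M4 where M: "\<And>n \<theta>. \<bar>ev (p n) \<theta>\<bar> \<le> M1" "\<And>n \<theta>. \<bar>ev (q n) \<theta>\<bar> \<le> M2"
    "\<And>n \<theta>. \<bar>ev (u n) \<theta>\<bar> \<le> M3" "\<And>n \<theta>. \<bar>ev (v n) \<theta>\<bar> \<le> M4"
    using lim by (metis trig_eval_bounded_of_convergent)
  define M where "M = max (max M1 M2) (max M3 M4)"
  have le_M: "\<bar>ev (p n) \<theta>\<bar> \<le> M" "\<bar>ev (q n) \<theta>\<bar> \<le> M" "\<bar>ev (u n) \<theta>\<bar> \<le> M" "\<bar>ev (v n) \<theta>\<bar> \<le> M" for n \<theta>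
    unfolding M_def using M[of n \<theta>] by linarith+
  have pos': "ev p' \<theta> > 0" "ev q' \<theta> > 0" for \<theta>
    using LIMSEQ_le_const[OF tendsto_trig_eval[of p p' \<theta>], of m] LIMSEQ_le_const[OF tendsto_trig_eval[of q q' \<theta>], of m]
      lim m by force+
  have pos: "ev (p n) \<theta> > 0" "ev (q n) \<theta> > 0" for n \<theta>
    using m(1) m(2,3)[of n \<theta>] by linarith+
  have "(\<lambda>n. torus_integral (\<lambda>\<theta>. entropy_deriv lam (ev (p n) \<theta>) (ev (q n) \<theta>) (ev (u n) \<theta>) (ev (v n) \<theta>)))
     \<longlonglongrightarrow> torus_integral (\<lambda>\<theta>. entropy_deriv lam (ev p' \<theta>) (ev q' \<theta>) (ev u' \<theta>) (ev v' \<theta>))"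
  proof (rule tendsto_torus_integral_dominated)
    show "(\<lambda>n. entropy_deriv lam (ev (p n) \<theta>) (ev (q n) \<theta>) (ev (u n) \<theta>) (ev (v n) \<theta>))
       \<longlonglongrightarrow> entropy_deriv lam (ev p' \<theta>) (ev q' \<theta>) (ev u' \<theta>) (ev v' \<theta>)" for \<theta>
      unfolding entropy_deriv_def using pos'[of \<theta>]
      by (intro tendsto_intros tendsto_trig_eval lim) auto
    show "\<bar>entropy_deriv lam (ev (p n) \<theta>) (ev (q n) \<theta>) (ev (u n) \<theta>) (ev (v n) \<theta>)\<bar>
       \<le> M * (ln (M / m) + 1) + M / m * M + \<bar>lam\<bar> * (M / m)" for n \<theta>
      using le_M[of n \<theta>] m(2,3)[of n \<theta>] by (intro abs_entropy_deriv_le m(1)) auto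
  qed (intro continuous_intros pos pos')+
  then show ?thesis
    unfolding grad_def by (intro tendsto_intros tendsto_coeff_inner lim)
qed

end

subsection \<open>Divergence of the integral at a zero\<close>

text \<open>\<open>2 * (cos x - 1)\<close> is the second difference
  \<open>cis x + cis (- x) - 2\<close>, equal to minus four times the squared sine of
  \<open>x / 2\<close>.\<close>

lemma abs_two_cos_minus_one_le: "\<bar>2 * (cos x - 1)\<bar> \<le> x\<^sup>2" for x :: real
proof -
  have "\<bar>2 * (cos x - 1)\<bar> = 4 * (sin (x / 2))\<^sup>2"
    using cos_double_sin[of "x / 2"] by (simp add: abs_mult)
  also have "(sin (x / 2))\<^sup>2 \<le> (x / 2)\<^sup>2"
    using abs_sin_x_le_abs_x[of "x / 2"] by (simp only: abs_le_square_iff)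
  finally show ?thesis
    by (simp add: power_divide)
qed

lemma pairing_diff: "pairing k (\<theta> - \<eta>) = pairing k \<theta> - pairing k \<eta>"
  by (simp add: pairing_def right_diff_distrib sum_subtractf)

lemma abs_pairing_le:
  assumes "\<And>j. \<bar>h $ j\<bar> \<le> r"
  shows "\<bar>pairing k h\<bar> \<le> (\<Sum>j\<in>UNIV. \<bar>real_of_int (k $ j)\<bar>) * r"
proof -
  have "\<bar>pairing k h\<bar> \<le> (\<Sum>j\<in>UNIV. \<bar>real_of_int (k $ j)\<bar> * \<bar>h $ j\<bar>)"
    unfolding pairing_def by (rule order_trans[OF sum_abs]) (simp add: abs_mult)
  also have "\<dots> \<le> (\<Sum>j\<in>UNIV. \<bar>real_of_int (k $ j)\<bar> * r)"
    by (intro sum_mono mult_left_mono assms) auto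
  finally show ?thesis
    by (simp add: sum_distrib_right)
qed

text \<open>
  Adding the value at \<open>\<theta>\<^sub>0 - h\<close>, which is nonnegative, cancels the first-order terms in \<open>h\<close>.
\<close>

lemma trig_eval_quadratic_at_zero:
  fixes p :: "int ^ 'd \<Rightarrow> complex"
  assumes "\<And>\<theta>. trig_eval \<Lambda> p \<theta> \<ge> 0" "trig_eval \<Lambda> p \<theta>0 = 0"
  obtains K where "K > 0"
    "\<And>\<theta> r. \<forall>j. \<bar>\<theta> $ j - \<theta>0 $ j\<bar> \<le> r \<Longrightarrow> trig_eval \<Lambda> p \<theta> \<le> K * r\<^sup>2"
proof -
  define S where "S k = (\<Sum>j\<in>UNIV. \<bar>real_of_int (k $ j)\<bar>)" for k :: "int ^ 'd"
  define K where "K = (\<Sum>k\<in>\<Lambda>. norm (p k) * (S k)\<^sup>2)"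
  have bound: "trig_eval \<Lambda> p \<theta> \<le> K * r\<^sup>2" if r: "\<forall>j. \<bar>\<theta> $ j - \<theta>0 $ j\<bar> \<le> r" for \<theta> r
  proof -
    define h where "h = \<theta> - \<theta>0"
    have pairs: "pairing k \<theta> = pairing k \<theta>0 + pairing k h" "pairing k (\<theta>0 - h) = pairing k \<theta>0 - pairing k h"
      for k :: "int ^ 'd"
      unfolding h_def pairing_diff by simp_all
    have term_eq: "p k * cis (- pairing k \<theta>) + p k * cis (- pairing k (\<theta>0 - h)) - 2 * (p k * cis (- pairing k \<theta>0)) =
        p k * cis (- pairing k \<theta>0) * of_real (2 * (cos (pairing k h) - 1))" for k
    proof -
      have "cis (- pairing k \<theta>) = cis (- pairing k \<theta>0) * cis (- pairing k h)"
        "cis (- pairing k (\<theta>0 - h)) = cis (- pairing k \<theta>0) * cis (pairing k h)"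
        by (simp_all add: pairs cis_mult)
      moreover have "of_real (2 * (cos x - 1)) = cis (- x) + cis x - 2" for x
        by (simp add: complex_eq_iff)
      ultimately show ?thesis
        by (simp only:) (simp only: ring_distribs mult_ac)
    qed
    have "trig_eval \<Lambda> p \<theta> \<le> trig_eval \<Lambda> p \<theta> + trig_eval \<Lambda> p (\<theta>0 - h) - 2 * trig_eval \<Lambda> p \<theta>0"
      using assms by simp
    also have "\<dots> = Re (\<Sum>k\<in>\<Lambda>. p k * cis (- pairing k \<theta>) + p k * cis (- pairing k (\<theta>0 - h))
        - 2 * (p k * cis (- pairing k \<theta>0)))"
      by (simp add: trig_eval_def sum.distrib sum_subtractf sum_distrib_left)
    also have "\<dots> \<le> norm (\<Sum>k\<in>\<Lambda>. p k * cis (- pairing k \<theta>0) * of_real (2 * (cos (pairing k h) - 1)))"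
      unfolding term_eq by (rule complex_Re_le_cmod)
    also have "\<dots> \<le> (\<Sum>k\<in>\<Lambda>. norm (p k * cis (- pairing k \<theta>0) * of_real (2 * (cos (pairing k h) - 1))))"
      by (rule norm_sum)
    also have "\<dots> \<le> (\<Sum>k\<in>\<Lambda>. norm (p k) * (S k * r)\<^sup>2)"
    proof (rule sum_mono)
      fix k
      have "\<bar>pairing k h\<bar> \<le> S k * r"
        unfolding S_def using r by (intro abs_pairing_le) (simp add: h_def)
      then have sq: "(pairing k h)\<^sup>2 \<le> (S k * r)\<^sup>2"
        by (meson abs_ge_zero abs_le_square_iff abs_le_D1 order_trans abs_ge_self)
      have "\<bar>2 * (cos (pairing k h) - 1)\<bar> \<le> (pairing k h)\<^sup>2"
        by (rule abs_two_cos_minus_one_le)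
      from order_trans[OF this sq] have "\<bar>2 * (cos (pairing k h) - 1)\<bar> \<le> (S k * r)\<^sup>2" .
      then show "norm (p k * cis (- pairing k \<theta>0) * of_real (2 * (cos (pairing k h) - 1))) \<le> norm (p k) * (S k * r)\<^sup>2"
        by (simp only: norm_mult norm_cis norm_of_real mult_1_right) (rule mult_left_mono, auto)
    qed
    also have "\<dots> = K * r\<^sup>2"
      by (simp add: K_def power_mult_distrib sum_distrib_left mult_ac)
    finally show ?thesis .
  qed
  have "K \<ge> 0"
    by (auto simp: K_def intro!: sum_nonneg)
  show thesis
  \<comment> \<open>\<open>K\<close> can be zero, for instance for the zero polynomial, whereas the
    constant must be positive to be divided by later.\<close>
  proof (rule that[of "K + 1"])
    show "trig_eval \<Lambda> p \<theta> \<le> (K + 1) * r\<^sup>2" if "\<forall>j. \<bar>\<theta> $ j - \<theta>0 $ j\<bar> \<le> r" for \<theta> r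
      using bound[OF that] by (simp add: algebra_simps) (smt (verit) zero_le_power2)
  qed (use \<open>K \<ge> 0\<close> in simp)
qed

lemma set_integral_mono_set:
  fixes f :: "_ \<Rightarrow> real"
  assumes "set_integrable M A f" "B \<in> sets M" "B \<subseteq> A" "\<And>x. f x \<ge> 0"
  shows "(LINT x:B|M. f x) \<le> (LINT x:A|M. f x)"
  unfolding set_lebesgue_integral_def
proof (rule integral_mono)
  show "integrable M (\<lambda>x. indicat_real B x *\<^sub>R f x)"
    using set_integrable_subset[OF assms(1-3)] by (simp add: set_integrable_def)
qed (use assms in \<open>auto simp: set_integrable_def indicator_def\<close>)

text \<open>
  Dyadic boxes of side \<open>\<pi> / 2 ^ (n + 1)\<close> approaching the zero from inside the torus each contribute at
  least a constant: the volume is at least of order \<open>r\<^sup>2\<close> because \<open>d \<le> 2\<close>, and the polynomial is at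
  most of order \<open>r\<^sup>2\<close>.
\<close>

lemma torus_integral_inverse_unbounded:
  fixes p :: "int ^ 'd \<Rightarrow> complex"
  assumes "CARD('d) \<le> 2" "\<And>\<theta>. trig_eval \<Lambda> p \<theta> \<ge> 0" "trig_eval \<Lambda> p \<theta>0 = 0" "\<theta>0 \<in> torus"
  obtains t where "0 < t" "t \<le> 1 / 2" "torus_integral (\<lambda>\<theta>. 1 / (trig_eval \<Lambda> p \<theta> + t)) > B"
proof -
  obtain K where K: "K > 0" "\<And>\<theta> r. \<forall>j. \<bar>\<theta> $ j - \<theta>0 $ j\<bar> \<le> r \<Longrightarrow> trig_eval \<Lambda> p \<theta> \<le> K * r\<^sup>2"
    using trig_eval_quadratic_at_zero[OF assms(2,3)] by blast
  define r where "r n = pi / 2 ^ n" for n :: nat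
  have r_Suc: "r n - r (Suc n) = r (Suc n)" "r (Suc n) = r n / 2" for n
    by (simp_all add: r_def field_simps)
  have r_pos: "r n > 0" for n
    by (simp add: r_def)
  have r_mono: "r n \<le> r m" if "m \<le> n" for m n
    using that by (auto simp: r_def intro!: divide_left_mono power_increasing)
  have r_le: "r n \<le> pi" for n
    using r_mono[of 0 n] by (simp add: r_def)
  \<comment> \<open>In each coordinate the box lies on the side of the zero with more room: to the
    right if the coordinate is nonpositive, to the left otherwise. As \<open>r n \<le> pi\<close>,
    it stays in the torus, at coordinate distances between \<open>r (Suc n)\<close> and
    \<open>r n\<close>.\<close>
  define l where "l n = (\<chi> j. if \<theta>0 $ j \<le> 0 then \<theta>0 $ j + r (Suc n) else \<theta>0 $ j - r n)" for n
  define b where "b n = box (l n) (l n + vec (r (Suc n)))" for n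
  have mem_b: "r (Suc n) < \<bar>\<theta> $ j - \<theta>0 $ j\<bar> \<and> \<bar>\<theta> $ j - \<theta>0 $ j\<bar> < r n
      \<and> - pi < \<theta> $ j \<and> \<theta> $ j \<le> pi" if "\<theta> \<in> b n" for \<theta> n j
  proof -
    have "l n $ j < \<theta> $ j \<and> \<theta> $ j < l n $ j + r (Suc n)"
      using that by (simp add: b_def mem_box_cart)
    moreover have "- pi < \<theta>0 $ j" "\<theta>0 $ j \<le> pi"
      using assms(4) by (auto simp: torus_def)
    ultimately show ?thesis
      using r_Suc[of n] r_pos[of n] r_le[of n] by (simp add: l_def split: if_splits)
  qed
  have b_torus: "b n \<subseteq> torus" for n
    using mem_b by (auto simp: torus_def)
  have disj: "disjoint_family b"
    unfolding disjoint_family_on_def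
  proof (intro ballI impI)
    have "b m \<inter> b n = {}" if "m < n" for m n
    proof (rule ccontr)
      assume "b m \<inter> b n \<noteq> {}"
      then obtain \<theta> where "\<theta> \<in> b m" "\<theta> \<in> b n"
        by blast
      \<comment> \<open>The distance ranges are disjoint in every coordinate, so a single one
        suffices; \<open>undefined\<close> names an arbitrary coordinate.\<close>
      then have "r (Suc m) < r n"
        using mem_b[of \<theta> m undefined] mem_b[of \<theta> n undefined] by linarith
      with r_mono[of "Suc m" n] that show False
        by simp
    qed
    then show "b m \<inter> b n = {}" if "m \<noteq> n" for m n
      using that by (metis inf_commute linorder_neqE_nat)
  qed
  have measure_b: "measure lborel (b n) = r (Suc n) ^ CARD('d)" for n
  proof -
    have inner: "vec (r (Suc n)) \<bullet> i = r (Suc n)" if "i \<in> Basis" for i :: "real ^ 'd"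
      using that by (auto simp: Basis_vec_def inner_axis)
    have "measure lborel (b n) = (\<Prod>i\<in>(Basis :: (real ^ 'd) set). vec (r (Suc n)) \<bullet> i)"
      unfolding b_def using r_pos[of "Suc n"]
      by (subst measure_lborel_box_eq) (simp add: inner inner_add_left less_imp_le)
    also have "\<dots> = (\<Prod>i\<in>(Basis :: (real ^ 'd) set). r (Suc n))"
      by (rule prod.cong[OF refl inner])
    finally show ?thesis
      by simp
  qed
  \<comment> \<open>The constant 16 serves both dimensions: the volume is a quarter of the square of
    \<open>r n\<close> for \<open>d = 2\<close>, and it is \<open>r n / 2\<close> for
    \<open>d = 1\<close>, where \<open>r n \<le> pi < 4\<close> suffices.\<close>
  have vol: "r (Suc n) ^ CARD('d) \<ge> (r n)\<^sup>2 / 16" for n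
  proof -
    have "CARD('d) > 0"
      by simp
    with assms(1) consider "CARD('d) = 1" | "CARD('d) = 2"
      by linarith
    then show ?thesis
    proof cases
      case 1
      have "r n * r n \<le> 4 * r n"
        using r_le[of n] pi_less_4 r_pos[of n] by (intro mult_right_mono) linarith+
      with 1 r_pos[of n] show ?thesis
        by (simp add: r_Suc power2_eq_square)
    qed (use r_pos[of n] in \<open>simp add: r_Suc power2_eq_square\<close>)
  qed
  define w where "w = (1 / (2 * pi)) ^ CARD('d)"
  have w: "w > 0"
    by (simp add: w_def)
  obtain N where N: "real N > B * (32 * K) / w"
    using reals_Archimedean2 by blast
  \<comment> \<open>On the first \<open>N\<close> boxes this shift at most doubles the quadratic
    bound on the denominator; with the 16 from the volume this gives the 32 in the choice of
    \<open>N\<close>. The cap 1/2 is the range of \<open>t\<close> in which the derivative is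
    estimated.\<close>
  define t where "t = min (1 / 2) (K * (r N)\<^sup>2)"
  have t: "0 < t" "t \<le> 1 / 2" "t \<le> K * (r N)\<^sup>2"
    using K r_pos[of N] by (auto simp: t_def)
  define f where "f \<theta> = 1 / (trig_eval \<Lambda> p \<theta> + t)" for \<theta>
  have pos: "trig_eval \<Lambda> p \<theta> + t > 0" for \<theta>
    using assms(2)[of \<theta>] t by linarith
  then have f_nonneg: "f \<theta> \<ge> 0" for \<theta>
    by (simp add: f_def less_imp_le)
  have "continuous_on UNIV f"
    unfolding f_def using pos by (intro continuous_intros) (auto simp: less_imp_neq[symmetric])
  note int_f = set_integrable_torus[OF this]
  have b_meas: "b n \<in> sets lborel" for n
    by (simp add: b_def)
  have int_b: "set_integrable lborel (b n) f" for n
    by (rule set_integrable_subset[OF int_f b_meas b_torus])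
  have part: "(LINT \<theta>:b n|lborel. f \<theta>) \<ge> 1 / (32 * K)" if "n < N" for n
  proof -
    have fin: "emeasure lborel (b n) \<noteq> \<infinity>"
      unfolding b_def using emeasure_lborel_box_finite[of "l n" "l n + vec (r (Suc n))"] by simp
    have rn: "(r N)\<^sup>2 \<le> (r n)\<^sup>2"
      using r_mono[of n N] that r_pos[of N] by (intro power_mono) auto
    have "1 / (32 * K) = (r n)\<^sup>2 / 16 * (1 / (2 * K * (r n)\<^sup>2))"
      using r_pos[of n] by simp
    also have "\<dots> \<le> r (Suc n) ^ CARD('d) * (1 / (2 * K * (r n)\<^sup>2))"
      using vol[of n] K(1) by (intro mult_right_mono) auto
    also have "\<dots> = (LINT \<theta>:b n|lborel. 1 / (2 * K * (r n)\<^sup>2))"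
      by (subst set_integral_const[OF b_meas fin]) (simp add: measure_b)
    also have "\<dots> \<le> (LINT \<theta>:b n|lborel. f \<theta>)"
    proof (rule set_integral_mono[OF _ int_b])
      show "set_integrable lborel (b n) (\<lambda>_. 1 / (2 * K * (r n)\<^sup>2))"
        by (rule set_integrable_subset[OF set_integrable_torus b_meas b_torus]) (rule continuous_on_const)
      fix \<theta> assume "\<theta> \<in> b n"
      then have "trig_eval \<Lambda> p \<theta> \<le> K * (r n)\<^sup>2"
        using mem_b by (intro K(2)) (blast intro: less_imp_le)
      moreover have "t \<le> K * (r n)\<^sup>2"
        using t(3) mult_left_mono[OF rn, of K] K(1) by linarith
      ultimately show "1 / (2 * K * (r n)\<^sup>2) \<le> f \<theta>"
        unfolding f_def using pos[of \<theta>] by (intro divide_left_mono) auto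
    qed
    finally show ?thesis .
  qed
  have "B < w * (real N * (1 / (32 * K)))"
    using N w K by (simp add: field_simps)
  also have "real N * (1 / (32 * K)) \<le> (\<Sum>n<N. LINT \<theta>:b n|lborel. f \<theta>)"
    using sum_bounded_below[of "{..<N}" "1 / (32 * K)" "\<lambda>n. LINT \<theta>:b n|lborel. f \<theta>"] part by simp
  also have "(\<Sum>n<N. LINT \<theta>:b n|lborel. f \<theta>) = (LINT \<theta>:(\<Union>n<N. b n)|lborel. f \<theta>)"
    using disj by (intro set_integral_finite_Union[symmetric] int_b b_meas) (auto simp: disjoint_family_on_def)
  also have "\<dots> \<le> (LINT \<theta>:torus|lborel. f \<theta>)"
    using b_torus by (intro set_integral_mono_set int_f f_nonneg) (auto simp: b_def)
  finally have "B < torus_integral f"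
    using w by (simp add: torus_integral_def w_def)
  with t show thesis
    by (intro that[of t]) (simp_all add: f_def[abs_def])
qed

subsection \<open>Existence of a minimiser\<close>

lemma bolzano_weierstrass_finite:
  fixes x :: "nat \<Rightarrow> 'i \<Rightarrow> complex"
  assumes "finite A" "\<And>k. k \<in> A \<Longrightarrow> bounded (range (\<lambda>n. x n k))"
  shows "\<exists>r l. strict_mono (r :: nat \<Rightarrow> nat) \<and> (\<forall>k\<in>A. (\<lambda>n. x (r n) k) \<longlonglongrightarrow> l k)"
  using assms
proof (induction A rule: finite_induct)
  case empty
  show ?case
    by (auto intro: exI[of _ id] strict_mono_id)
next
  case (insert j A)
  then obtain r l where r: "strict_mono (r :: nat \<Rightarrow> nat)" and l: "\<And>k. k \<in> A \<Longrightarrow> (\<lambda>n. x (r n) k) \<longlonglongrightarrow> l k"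
    by auto
  have "bounded (range (\<lambda>n. x (r n) j))"
    using insert.prems[of j] by (auto intro: bounded_subset)
  then obtain z s where s: "strict_mono (s :: nat \<Rightarrow> nat)" and z: "((\<lambda>n. x (r n) j) \<circ> s) \<longlonglongrightarrow> z"
    using bounded_imp_convergent_subsequence by blast
  have "(\<lambda>n. x ((r \<circ> s) n) k) \<longlonglongrightarrow> (l(j := z)) k" if "k \<in> insert j A" for k
    using z LIMSEQ_subseq_LIMSEQ[OF l s, of k] that insert.hyps by (auto simp: o_def)
  with strict_mono_o[OF r s] show ?case
    by blast
qed

text \<open>Links the coefficientwise limits of subsequences to the product topology, in which the
  closure in \<open>pos_dual\<close> is taken.\<close>

lemma tendsto_fun_componentwise:
  fixes f :: "'a \<Rightarrow> 'b \<Rightarrow> 'c :: topological_space"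
  assumes "\<And>k. ((\<lambda>n. f n k) \<longlongrightarrow> l k) F"
  shows "(f \<longlongrightarrow> l) F"
proof -
  have "limitin (product_topology (\<lambda>_. euclidean) UNIV) f l F"
    using assms by (simp add: limitin_componentwise)
  then show ?thesis
    by (simp add: euclidean_product_topology)
qed

text \<open>
  As \<open>t \<rightarrow> 0\<close> the only unbounded term of the wrong sign is \<open>- ln Qt\<close>; by the AM-GM inequality
  \<open>(Pt / Qt + lam / Pt) / 2 \<ge> sqrt (lam / Qt)\<close> it is absorbed by the two terms that tend to \<open>-\<infinity>\<close>.
\<close>

lemma entropy_deriv_towards_one_le:
  fixes P Q N t lam :: real
  assumes "0 < t" "t \<le> 1 / 2" "0 \<le> P" "P \<le> N" "0 \<le> Q" "Q \<le> N" "lam > 0"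
  defines "Pt \<equiv> (1 - t) * P + t" and "Qt \<equiv> (1 - t) * Q + t"
  shows "entropy_deriv lam Pt Qt (1 - P) (1 - Q) \<le>
    (1 + N * N + 2 * (N + 1) + 2 * lam + (2 * ln 2 - 2 - ln lam)) - (Pt / Qt + lam / Pt) / 2"
proof -
  have half: "P / 2 \<le> (1 - t) * P" "Q / 2 \<le> (1 - t) * Q"
    using mult_right_mono[of "1 / 2" "1 - t" P] mult_right_mono[of "1 / 2" "1 - t" Q] assms by auto
  have pos: "Pt > 0" "Qt > 0"
    unfolding Pt_def Qt_def using assms by (auto intro: add_nonneg_pos)
  have le2: "P \<le> 2 * Pt" "Q \<le> 2 * Qt"
    unfolding Pt_def Qt_def using half \<open>0 < t\<close> by argo+
  have Pt_1: "Pt - 1 = (1 - t) * (P - 1)" and Qt_1: "Qt - 1 = (1 - t) * (Q - 1)"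
    by (simp_all add: Pt_def Qt_def algebra_simps)
  have "(1 - t) * P \<le> 1 * P"
    using assms by (intro mult_right_mono) auto
  then have Pt_le: "Pt \<le> N + 1"
    unfolding Pt_def using assms by linarith
  \<comment> \<open>\<open>Pt\<close> lies between \<open>P\<close> and 1, so \<open>ln Pt\<close>
    and \<open>P - 1\<close> never have opposite signs.\<close>
  have 1: "(1 - P) * ln Pt \<le> 0"
  proof (cases "P \<le> 1")
    case True
    then have "Pt \<le> 1"
      using Pt_1 assms mult_nonneg_nonpos[of "1 - t" "P - 1"] by linarith
    with True pos show ?thesis
      by (auto intro: mult_nonneg_nonpos)
  next
    case False
    then have "Pt \<ge> 1"
      using Pt_1 assms mult_nonneg_nonneg[of "1 - t" "P - 1"] by linarith
    with False show ?thesis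
      by (auto intro: mult_nonpos_nonneg)
  qed
  have "ln Qt \<le> N"
  proof -
    have "(1 - t) * (Q - 1) \<le> N"
    proof -
      have "(1 - t) * Q \<le> 1 * Q"
        using assms by (intro mult_right_mono) auto
      moreover have "(1 - t) * (Q - 1) = (1 - t) * Q - (1 - t)"
        by (simp add: algebra_simps)
      ultimately show ?thesis
        using assms(1-7) by linarith
    qed
    with ln_le_minus_one[OF pos(2)] Qt_1 show ?thesis
      by linarith
  qed
  then have 2: "P * ln Qt \<le> N * N"
    using mult_left_mono[of "ln Qt" N P] mult_right_mono[of P N N] assms by linarith
  have "Pt / Qt * Q \<le> Pt / Qt * (2 * Qt)"
    using le2 pos by (intro mult_left_mono) auto
  also have "\<dots> = 2 * Pt"
    using pos by simp
  also have "\<dots> \<le> 2 * (N + 1)"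
    using Pt_le by simp
  finally have 3: "Pt / Qt * Q \<le> 2 * (N + 1)" .
  have 4: "lam * (P / Pt) \<le> 2 * lam"
  proof -
    have "P / Pt \<le> 2"
      using le2(1) pos(1) by (simp add: pos_divide_le_eq)
    with mult_left_mono[OF this, of lam] \<open>lam > 0\<close> show ?thesis
      by simp
  qed
  have 5: "- ln Qt \<le> (Pt / Qt + lam / Pt) / 2 + (2 * ln 2 - 2 - ln lam)"
  proof -
    define A where "A = (Pt / Qt + lam / Pt) / 2"
    have "A > 0"
      unfolding A_def using pos assms by (simp add: add_pos_pos)
    have "A\<^sup>2 - lam / Qt = ((Pt / Qt - lam / Pt) / 2)\<^sup>2"
      using pos unfolding A_def by (simp add: power2_eq_square field_simps)
    then have "lam / Qt \<le> A\<^sup>2"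
      by (smt (verit) zero_le_power2)
    then have "ln (lam / Qt) \<le> ln (A\<^sup>2)"
      using pos assms \<open>A > 0\<close> by (subst ln_le_cancel_iff) auto
    then have "ln lam - ln Qt \<le> 2 * ln A"
      using pos assms \<open>A > 0\<close> by (simp add: ln_div ln_realpow)
    \<comment> \<open>The tangent of \<open>2 * ln A\<close> at \<open>A = 2\<close> has slope
      exactly 1. The logarithm therefore consumes one copy of \<open>A\<close>, half of the singular
      terms, and leaves the other half.\<close>
    moreover have "ln A - ln 2 \<le> A / 2 - 1"
      using ln_le_minus_one[of "A / 2"] \<open>A > 0\<close> by (simp add: ln_div)
    ultimately show ?thesis
      unfolding A_def[symmetric] by linarith
  qed
  have "entropy_deriv lam Pt Qt (1 - P) (1 - Q) =
      (1 - P) * ln Pt + P * ln Qt - ln Qt + (1 - P) - Pt / Qt + Pt / Qt * Q - lam / Pt + lam * (P / Pt)"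
    using pos by (simp add: entropy_deriv_def ln_div algebra_simps diff_divide_distrib)
  moreover have "x1 + x2 - l + (1 - P) - a + x3 - b + x4 \<le> (1 + n2 + n3 + n4 + k) - (a + b) / 2"
    if "x1 \<le> 0" "x2 \<le> n2" "x3 \<le> n3" "x4 \<le> n4" "- l \<le> (a + b) / 2 + k" for x1 x2 x3 x4 n2 n3 n4 l a b k :: real
    using that \<open>0 \<le> P\<close> by argo
  ultimately show ?thesis
    using 1 2 3 4 5 by presburger
qed

section \<open>Compactness and coercivity\<close>

context cepstral_problem
begin

lemma pos_polys_convergent_subseq:
  assumes "\<And>n. p n \<in> pos_polys \<Lambda>" "\<And>n. Re (p n 0) \<le> B"
  obtains r p' where "strict_mono (r :: nat \<Rightarrow> nat)" "p' \<in> trig_polys \<Lambda>"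
    "\<And>k. (\<lambda>n. p (r n) k) \<longlonglongrightarrow> p' k" "\<And>\<theta>. ev p' \<theta> \<ge> 0"
proof -
  have "bounded (range (\<lambda>n. p n k))" for k
    unfolding bounded_iff using pos_polys_norm_le[OF index_set assms(1)] assms(2)
    by (auto intro!: exI[of _ B] intro: order_trans)
  then obtain r l where r: "strict_mono (r :: nat \<Rightarrow> nat)" and l: "\<And>k. k \<in> \<Lambda> \<Longrightarrow> (\<lambda>n. p (r n) k) \<longlonglongrightarrow> l k"
    using bolzano_weierstrass_finite[OF finite_index, of p] by blast
  \<comment> \<open>The limits \<open>l\<close> are unspecified off \<Lambda>, where a polynomial
    must vanish.\<close>
  define p' where "p' k = (if k \<in> \<Lambda> then l k else 0)" for k
  have lim: "(\<lambda>n. p (r n) k) \<longlonglongrightarrow> p' k" for k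
    using l[of k] pos_polysD(1)[OF assms(1)] by (simp add: p'_def trig_polys_def)
  have "p' (- k) = cnj (p' k)" if "k \<in> \<Lambda>" for k
  proof (rule LIMSEQ_unique[OF lim])
    have "(\<lambda>n. cnj (p (r n) k)) \<longlonglongrightarrow> cnj (p' k)"
      by (intro tendsto_intros lim)
    then show "(\<lambda>n. p (r n) (- k)) \<longlonglongrightarrow> cnj (p' k)"
      using pos_polysD(1)[OF assms(1)] that by (simp add: trig_polys_def hermitian_on_def)
  qed
  then have "p' \<in> trig_polys \<Lambda>"
    by (simp add: trig_polys_def hermitian_on_def p'_def)
  moreover have "ev p' \<theta> \<ge> 0" for \<theta>
    using tendsto_trig_eval[of "\<lambda>n. p (r n)" p' \<theta>] lim pos_polysD(2)[OF assms(1)]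
    by (intro LIMSEQ_le_const[of "\<lambda>n. ev (p (r n)) \<theta>"]) (auto intro!: exI[of _ 0] less_imp_le)
  ultimately show thesis
    using that r lim by blast
qed

text \<open>Strict positivity becomes uniform by compactness: counterexamples scaled to zeroth
  coefficient 1 would accumulate at an element of the closure that still has zeroth coefficient 1,
  hence is nonzero, but has nonpositive pairing with \<open>c\<close>.\<close>

lemma coeff_inner_dual_lower_bound:
  obtains \<kappa> where "\<kappa> > 0" "\<And>q. q \<in> pos_polys \<Lambda> \<Longrightarrow> coeff_inner \<Lambda> c q \<ge> \<kappa> * Re (q 0)"
proof (rule ccontr)
  assume "\<not> thesis"
  then have "\<exists>q\<in>pos_polys \<Lambda>. coeff_inner \<Lambda> c q < 1 / real (Suc n) * Re (q 0)" for n
    using that[of "1 / real (Suc n)"] by (force simp: not_le)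
  then obtain q where q: "\<And>n. q n \<in> pos_polys \<Lambda>" "\<And>n. coeff_inner \<Lambda> c (q n) < 1 / real (Suc n) * Re (q n 0)"
    by metis
  have q0: "Re (q n 0) > 0" for n
  proof -
    have "torus_integral (ev (q n)) \<ge> 0"
      using torus_integral_mono[of "\<lambda>_. 0" "ev (q n)"] pos_polysD(2)[OF q(1)[of n]]
      by (simp add: continuous_intros less_imp_le)
    moreover have "torus_integral (ev (q n)) \<noteq> 0"
    proof
      assume "torus_integral (ev (q n)) = 0"
      then have "ev (q n) 0 = 0"
        using pos_polysD(2)[OF q(1)[of n]]
        by (intro torus_integral_eq_0D) (auto intro: less_imp_le continuous_intros simp: torus_def)
      with pos_polysD(2)[OF q(1)[of n], of 0] show False
        by simp
    qed
    ultimately show ?thesis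
      by (simp add: torus_integral_trig_eval[OF index_set pos_polysD(1)[OF q(1)]])
  qed
  \<comment> \<open>The vanishing second summand only brings the scaling into the form of the
    \<open>lincomb\<close> lemmas.\<close>
  define q' where "q' n = (\<lambda>k. (1 / Re (q n 0)) *\<^sub>R q n k + 0 *\<^sub>R q n k)" for n
  have q'_pos: "q' n \<in> pos_polys \<Lambda>" for n
    unfolding q'_def using q0[of n] by (intro pos_polys_lincomb q) auto
  have q'_0: "q' n 0 = 1" for n
  proof -
    have "q n 0 = of_real (Re (q n 0))"
      by (rule trig_polys_coeff_0[OF index_set pos_polysD(1)[OF q(1)]])
    then show ?thesis
      using q0[of n] by (simp add: q'_def complex_eq_iff)
  qed
  have small: "coeff_inner \<Lambda> c (q' n) \<le> 1 / real (Suc n)" for n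
    unfolding q'_def coeff_inner_lincomb using q(2)[of n] q0[of n] by (simp add: field_simps)
  obtain r l where r: "strict_mono r" and l: "l \<in> trig_polys \<Lambda>" "\<And>k. (\<lambda>n. q' (r n) k) \<longlonglongrightarrow> l k"
    using pos_polys_convergent_subseq[of q' 1, OF q'_pos] q'_0 by (metis one_complex.sel(1) order_refl)
  have "(\<lambda>n. q' (r n)) \<longlonglongrightarrow> l"
    by (intro tendsto_fun_componentwise l)
  then have "l \<in> closure (pos_polys \<Lambda>)"
    by (rule Lim_in_closed_set[OF closed_closure _ sequentially_bot, rotated])
       (use q'_pos closure_subset in \<open>auto intro!: always_eventually\<close>)
  moreover have "l 0 = 1"
    using l(2)[of 0] q'_0 by (simp add: LIMSEQ_const_iff)
  ultimately have "coeff_inner \<Lambda> c l > 0"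
    using c_dual by (auto simp: pos_dual_def)
  moreover have "coeff_inner \<Lambda> c l \<le> 0"
  proof (rule LIMSEQ_le)
    show "(\<lambda>n. coeff_inner \<Lambda> c (q' (r n))) \<longlonglongrightarrow> coeff_inner \<Lambda> c l"
      by (intro tendsto_coeff_inner l)
    show "(\<lambda>n. 1 / real (Suc (r n))) \<longlonglongrightarrow> 0"
      using LIMSEQ_subseq_LIMSEQ[OF LIMSEQ_inverse_real_of_nat r] by (simp add: o_def inverse_eq_divide)
  qed (use small in blast)
  ultimately show False
    by simp
qed

text \<open>The entropy terms can fall only to minus a logarithm of \<open>Re (q 0)\<close>, because
  \<open>p\<close> has mean 1 and \<open>q\<close> is pointwise at most a multiple of
  \<open>Re (q 0)\<close>. Half of the linear growth of the pairing with \<open>c\<close> absorbs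
  this logarithm.\<close>

lemma objective_coercive:
  obtains \<kappa> C where "\<kappa> > 0" "\<And>p q. p \<in> pos_polys_normalized \<Lambda> \<Longrightarrow> q \<in> pos_polys \<Lambda> \<Longrightarrow>
    J (p, q) \<ge> \<kappa> * Re (q 0) - C"
proof -
  obtain \<kappa> where \<kappa>: "\<kappa> > 0" "\<And>q. q \<in> pos_polys \<Lambda> \<Longrightarrow> coeff_inner \<Lambda> c q \<ge> \<kappa> * Re (q 0)"
    using coeff_inner_dual_lower_bound by blast
  define G where "G = (\<Sum>k\<in>\<Lambda>. norm (\<gamma> k))"
  define N where "N = real (card \<Lambda>)"
  have N: "N > 0"
    using index_set by (auto simp: N_def index_set_def card_gt_0_iff)
  have "J (p, q) \<ge> \<kappa> / 2 * Re (q 0) - (G + ln (2 * N / \<kappa>))"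
    if p: "p \<in> pos_polys_normalized \<Lambda>" and q: "q \<in> pos_polys \<Lambda>" for p q
  proof -
    have p': "p \<in> pos_polys \<Lambda>" "p 0 = 1"
      using p by (auto simp: pos_polys_normalized_def)
    note pos = pos_polysD(2)[OF p'(1)] pos_polysD(2)[OF q]
    have "coeff_inner \<Lambda> \<gamma> p \<le> norm (\<Sum>k\<in>\<Lambda>. \<gamma> k * cnj (p k))"
      unfolding coeff_inner_def by (rule complex_Re_le_cmod)
    also have "\<dots> \<le> G"
      unfolding G_def using pos_polys_norm_le[OF index_set p'(1)] p'(2)
      by (intro sum_norm_le) (auto simp: norm_mult intro!: mult_left_le)
    finally have gam: "coeff_inner \<Lambda> \<gamma> p \<le> G" .
    define L where "L = ln (N * Re (q 0))"
    have q_le: "ev q \<theta> \<le> N * Re (q 0)" for \<theta>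
      using abs_trig_eval_le[of \<Lambda> q \<theta>] sum_bounded_above[of \<Lambda> "\<lambda>k. norm (q k)" "Re (q 0)"]
        pos_polys_norm_le[OF index_set q] by (simp add: N_def)
    then have q0: "Re (q 0) > 0"
      using pos(2)[of 0] N by (smt (verit) zero_less_mult_pos)
    \<comment> \<open>The minorant is affine in the value of \<open>p\<close>, so its integral
      depends only on \<open>p 0 = 1\<close> and equals \<open>- L\<close>.\<close>
    have dens: "entropy_density lam (ev p \<theta>) (ev q \<theta>) \<ge> (1 - lam - L) * ev p \<theta> + (lam - 1)" for \<theta>
    proof -
      have "ln (1 / ev p \<theta>) \<le> 1 / ev p \<theta> - 1"
        using pos by (intro ln_le_minus_one) simp
      then have "ev p \<theta> * (- ln (ev p \<theta>)) \<le> ev p \<theta> * (1 / ev p \<theta> - 1)"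
        using pos(1)[of \<theta>] by (intro mult_left_mono) (auto simp: ln_div less_imp_le)
      then have "ev p \<theta> * ln (ev p \<theta>) \<ge> ev p \<theta> - 1"
        using pos(1)[of \<theta>] by (simp add: algebra_simps)
      moreover have "lam * ln (ev p \<theta>) \<le> lam * (ev p \<theta> - 1)"
        using lam_pos pos by (intro mult_left_mono ln_le_minus_one) auto
      moreover have "ev p \<theta> * ln (ev q \<theta>) \<le> ev p \<theta> * L"
        unfolding L_def using pos q_le by (intro mult_left_mono ln_mono) (auto simp: less_imp_le)
      moreover have "entropy_density lam (ev p \<theta>) (ev q \<theta>) =
          ev p \<theta> * ln (ev p \<theta>) - ev p \<theta> * ln (ev q \<theta>) - lam * ln (ev p \<theta>)"
        using pos(1)[of \<theta>] pos(2)[of \<theta>]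
        by (simp add: entropy_density_def ln_div right_diff_distrib)
      moreover have "(1 - lam - L) * ev p \<theta> + (lam - 1) = ev p \<theta> - 1 - lam * (ev p \<theta> - 1) - ev p \<theta> * L"
        by (simp add: algebra_simps)
      ultimately show ?thesis
        by linarith
    qed
    have "- L = torus_integral (\<lambda>\<theta>. (1 - lam - L) * ev p \<theta> + (lam - 1))"
      using torus_integral_trig_eval[OF index_set pos_polysD(1)[OF p'(1)]] p'(2)
      by (subst torus_integral_add) (auto intro!: continuous_intros simp: torus_integral_mult_right)
    also have "\<dots> \<le> torus_integral (\<lambda>\<theta>. entropy_density lam (ev p \<theta>) (ev q \<theta>))"
      by (intro torus_integral_mono dens continuous_intros pos)
    finally have "J (p, q) \<ge> \<kappa> * Re (q 0) - G - L"
      using gam \<kappa>(2)[OF q] unfolding objective_eq[OF p'(1) q] by linarith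
    moreover have "ln (\<kappa> / 2 * Re (q 0)) \<le> \<kappa> / 2 * Re (q 0) - 1"
      using \<kappa>(1) q0 by (intro ln_le_minus_one) auto
    moreover have "L = ln (\<kappa> / 2 * Re (q 0)) + ln (2 * N / \<kappa>)"
      unfolding L_def using \<kappa>(1) q0 N by (simp add: ln_mult ln_div)
    ultimately show ?thesis
      by linarith
  qed
  with that[of "\<kappa> / 2"] \<kappa>(1) show thesis
    by auto
qed

section \<open>Minimising sequences and positivity of their limits\<close>

lemma feasible_unit: "(unit_coeffs, unit_coeffs) \<in> feasible \<Lambda>"
  using unit_coeffs_pos[OF index_set] by (auto simp: feasible_def pos_polys_normalized_def)

lemma feasible_iff:
  "(p, q) \<in> feasible \<Lambda> \<longleftrightarrow> p \<in> pos_polys \<Lambda> \<and> p 0 = 1 \<and> q \<in> pos_polys \<Lambda>"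
  by (auto simp: feasible_def pos_polys_normalized_def)

lemma bdd_below_objective: "bdd_below (J ` feasible \<Lambda>)"
proof -
  obtain \<kappa> C where coercive: "\<kappa> > 0" "\<And>p q. p \<in> pos_polys_normalized \<Lambda> \<Longrightarrow> q \<in> pos_polys \<Lambda> \<Longrightarrow>
      J (p, q) \<ge> \<kappa> * Re (q 0) - C"
    using objective_coercive by blast
  have "J x \<ge> - C" if x_feas: "x \<in> feasible \<Lambda>" for x
  proof -
    obtain p q where x: "x = (p, q)" "p \<in> pos_polys_normalized \<Lambda>" "q \<in> pos_polys \<Lambda>"
      using x_feas by (cases x) (auto simp: feasible_def)
    have "Re (q 0) \<ge> 0"
      using pos_polys_norm_le[OF index_set x(3), of 0] norm_ge_zero[of "q 0"] by linarith
    then have "\<kappa> * Re (q 0) \<ge> 0"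
      using coercive(1) by simp
    with coercive(2)[OF x(2,3)] x(1) show ?thesis
      by simp
  qed
  then show ?thesis
    by (auto intro!: bdd_belowI)
qed

lemma minimising_sequence:
  obtains p q p' q' where
    "\<And>n. (p n, q n) \<in> feasible \<Lambda>" "(\<lambda>n. J (p n, q n)) \<longlonglongrightarrow> Inf (J ` feasible \<Lambda>)"
    "\<And>k. (\<lambda>n. p n k) \<longlonglongrightarrow> p' k" "\<And>k. (\<lambda>n. q n k) \<longlonglongrightarrow> q' k"
    "p' \<in> trig_polys \<Lambda>" "p' 0 = 1" "\<And>\<theta>. ev p' \<theta> \<ge> 0" "q' \<in> trig_polys \<Lambda>" "\<And>\<theta>. ev q' \<theta> \<ge> 0"
proof -
  define m where "m = Inf (J ` feasible \<Lambda>)"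
  have lower: "m \<le> J x" if "x \<in> feasible \<Lambda>" for x
    unfolding m_def using that bdd_below_objective by (intro cInf_lower) auto
  have "\<exists>x\<in>feasible \<Lambda>. J x < m + 1 / real (Suc n)" for n
    using cInf_lessD[of "J ` feasible \<Lambda>" "m + 1 / real (Suc n)"] feasible_unit
    by (auto simp: m_def)
  then obtain x where x: "\<And>n. x n \<in> feasible \<Lambda>" "\<And>n. J (x n) < m + 1 / real (Suc n)"
    by metis
  obtain \<kappa> C where coercive: "\<kappa> > 0" "\<And>p q. p \<in> pos_polys_normalized \<Lambda> \<Longrightarrow> q \<in> pos_polys \<Lambda> \<Longrightarrow>
      J (p, q) \<ge> \<kappa> * Re (q 0) - C"
    using objective_coercive by blast
  have pos: "fst (x n) \<in> pos_polys_normalized \<Lambda>" "fst (x n) \<in> pos_polys \<Lambda>" "fst (x n) 0 = 1"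
    "snd (x n) \<in> pos_polys \<Lambda>" for n
    using x(1)[of n] by (auto simp: feasible_def pos_polys_normalized_def)
  have bound: "Re (snd (x n) 0) \<le> (m + 1 + C) / \<kappa>" for n
  proof -
    have "1 / real (Suc n) \<le> 1"
      by simp
    moreover have "Re (snd (x n) 0) * \<kappa> - C \<le> J (x n)"
      using coercive(2)[OF pos(1,4), of n n] by (simp add: mult.commute)
    ultimately have "Re (snd (x n) 0) * \<kappa> \<le> m + 1 + C"
      using x(2)[of n] by argo
    with coercive(1) show ?thesis
      by (simp add: pos_le_divide_eq)
  qed
  have "Re (fst (x n) 0) \<le> 1" for n
    by (simp add: pos)
  from pos_polys_convergent_subseq[of "\<lambda>n. fst (x n)", OF pos(2) this]
  obtain r p' where r: "strict_mono (r :: nat \<Rightarrow> nat)" and p': "p' \<in> trig_polys \<Lambda>"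
    "\<And>k. (\<lambda>n. fst (x (r n)) k) \<longlonglongrightarrow> p' k" "\<And>\<theta>. ev p' \<theta> \<ge> 0"
    by metis
  from pos_polys_convergent_subseq[of "\<lambda>n. snd (x (r n))", OF pos(4) bound]
  obtain s q' where s: "strict_mono (s :: nat \<Rightarrow> nat)" and q': "q' \<in> trig_polys \<Lambda>"
    "\<And>k. (\<lambda>n. snd (x (r (s n))) k) \<longlonglongrightarrow> q' k" "\<And>\<theta>. ev q' \<theta> \<ge> 0"
    by metis
  show thesis
  proof (rule that[of "\<lambda>n. fst (x (r (s n)))" "\<lambda>n. snd (x (r (s n)))" p' q'])
    have "(\<lambda>n. J (x n)) \<longlonglongrightarrow> m"
    proof (rule tendsto_sandwich[of "\<lambda>_. m" _ _ "\<lambda>n. m + 1 / real (Suc n)"])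
      show "\<forall>\<^sub>F n in sequentially. J (x n) \<le> m + 1 / real (Suc n)"
        using x(2) by (auto intro!: always_eventually less_imp_le)
      show "(\<lambda>n. m + 1 / real (Suc n)) \<longlonglongrightarrow> m"
        using LIMSEQ_inverse_real_of_nat_add[of m] by (simp add: inverse_eq_divide)
    qed (use lower x(1) in auto)
    from LIMSEQ_subseq_LIMSEQ[OF this strict_mono_o[OF r s]]
    show "(\<lambda>n. J (fst (x (r (s n))), snd (x (r (s n))))) \<longlonglongrightarrow> Inf (J ` feasible \<Lambda>)"
      by (simp add: o_def m_def)
    show lim: "(\<lambda>n. fst (x (r (s n))) k) \<longlonglongrightarrow> p' k" for k
      using LIMSEQ_subseq_LIMSEQ[OF p'(2) s] by (simp add: o_def)
    show "p' 0 = 1"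
      using lim[of 0] by (simp add: pos LIMSEQ_const_iff)
  qed (use x p' q' in auto)
qed

text \<open>
  A negative derivative at the shifted limit point would, by convexity, push \<open>J\<close> below its infimum when
  moving from late points of the minimising sequence towards \<open>(1, 1)\<close>.
\<close>

lemma grad_towards_unit_nonneg:
  assumes feas: "\<And>n. (p n, q n) \<in> feasible \<Lambda>" and J: "(\<lambda>n. J (p n, q n)) \<longlonglongrightarrow> Inf (J ` feasible \<Lambda>)"
    and lim: "\<And>k. (\<lambda>n. p n k) \<longlonglongrightarrow> p' k" "\<And>k. (\<lambda>n. q n k) \<longlonglongrightarrow> q' k" and t: "0 < t" "t \<le> 1 / 2"
  shows "grad (\<lambda>k. (1 - t) *\<^sub>R p' k + t *\<^sub>R unit_coeffs k) (\<lambda>k. (1 - t) *\<^sub>R q' k + t *\<^sub>R unit_coeffs k)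
    (\<lambda>k. unit_coeffs k - p' k) (\<lambda>k. unit_coeffs k - q' k) \<ge> 0"
proof -
  define S where "S a = (\<lambda>k. (1 - t) *\<^sub>R a k + t *\<^sub>R unit_coeffs k)" for a :: "int ^ 'd \<Rightarrow> complex"
  define D where "D a = (\<lambda>k. unit_coeffs k - a k)" for a :: "int ^ 'd \<Rightarrow> complex"
  have unit: "unit_coeffs \<in> pos_polys \<Lambda>" "(unit_coeffs :: int ^ 'd \<Rightarrow> complex) 0 = 1"
    using unit_coeffs_pos[OF index_set] by (auto simp: pos_polys_normalized_def)
  have pos: "p n \<in> pos_polys \<Lambda>" "p n 0 = 1" "q n \<in> pos_polys \<Lambda>" for n
    using feas by (auto simp: feasible_iff)
  have S_pos: "S a \<in> pos_polys \<Lambda>" if "a \<in> pos_polys \<Lambda>" for a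
    unfolding S_def using that unit t by (intro pos_polys_lincomb) auto
  \<comment> \<open>This bound does not depend on \<open>n\<close>; it is what
    \<open>tendsto_grad\<close> requires even if the limits have zeros.\<close>
  have lower: "t \<le> ev (S a) \<theta>" if "a \<in> pos_polys \<Lambda>" for a \<theta>
  proof -
    have "(1 - t) * ev a \<theta> \<ge> 0"
      using pos_polysD(2)[OF that, of \<theta>] t by simp
    then show ?thesis
      unfolding S_def trig_eval_lincomb by (simp add: index_set)
  qed
  have G: "(\<lambda>n. grad (S (p n)) (S (q n)) (D (p n)) (D (q n))) \<longlonglongrightarrow> grad (S p') (S q') (D p') (D q')"
    using t lower pos unfolding S_def D_def by (intro tendsto_grad[of _ _ _ _ _ _ _ _ t] tendsto_intros lim) auto
  have "Inf (J ` feasible \<Lambda>) \<le> J (p n, q n) + t * grad (S (p n)) (S (q n)) (D (p n)) (D (q n))" for n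
  proof -
    have "(S (p n), S (q n)) \<in> feasible \<Lambda>"
      using pos unit S_pos by (simp add: feasible_iff) (simp add: S_def)
    then have "Inf (J ` feasible \<Lambda>) \<le> J (S (p n), S (q n))"
      by (intro cInf_lower bdd_below_objective) auto
    also have "\<dots> \<le> J (p n, q n) - grad (S (p n)) (S (q n)) (\<lambda>k. p n k - S (p n) k) (\<lambda>k. q n k - S (q n) k)"
      using objective_above_tangent(1)[OF S_pos S_pos, of "p n" "q n" "p n" "q n"] pos by simp
    \<comment> \<open>Returning from the shifted pair to \<open>(p n, q n)\<close> means moving by
      \<open>- t\<close> times the direction \<open>D\<close>.\<close>
    also have "grad (S (p n)) (S (q n)) (\<lambda>k. p n k - S (p n) k) (\<lambda>k. q n k - S (q n) k) =
        grad (S (p n)) (S (q n)) (\<lambda>k. (- t) *\<^sub>R D (p n) k + 0 *\<^sub>R D (p n) k)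
          (\<lambda>k. (- t) *\<^sub>R D (q n) k + 0 *\<^sub>R D (q n) k)"
      by (simp add: S_def D_def algebra_simps)
    also have "\<dots> = - t * grad (S (p n)) (S (q n)) (D (p n)) (D (q n))"
      using pos by (subst grad_lincomb) (auto intro: S_pos)
    finally show ?thesis
      by simp
  qed
  then have "Inf (J ` feasible \<Lambda>) \<le> Inf (J ` feasible \<Lambda>) + t * grad (S p') (S q') (D p') (D q')"
    by (intro LIMSEQ_le_const[OF tendsto_add[OF J tendsto_mult[OF tendsto_const G]]]) auto
  then show ?thesis
    using t unfolding S_def D_def by (simp add: zero_le_mult_iff)
qed

lemma pos_polys_closed_no_zero:
  assumes "p \<in> trig_polys \<Lambda>" "\<And>\<theta>. ev p \<theta> \<ge> 0" "p \<notin> pos_polys \<Lambda>"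
  obtains \<theta> where "\<theta> \<in> torus" "ev p \<theta> = 0"
  using assms by (force simp: pos_polys_def not_less intro: antisym)

lemma limit_of_minimising_sequence_positive:
  assumes dim: "CARD('d) \<le> 2"
    and p': "p' \<in> trig_polys \<Lambda>" "\<And>\<theta>. ev p' \<theta> \<ge> 0" and q': "q' \<in> trig_polys \<Lambda>" "\<And>\<theta>. ev q' \<theta> \<ge> 0"
    and nonneg: "\<And>t. 0 < t \<Longrightarrow> t \<le> 1 / 2 \<Longrightarrow>
      grad (\<lambda>k. (1 - t) *\<^sub>R p' k + t *\<^sub>R unit_coeffs k) (\<lambda>k. (1 - t) *\<^sub>R q' k + t *\<^sub>R unit_coeffs k)
        (\<lambda>k. unit_coeffs k - p' k) (\<lambda>k. unit_coeffs k - q' k) \<ge> 0"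
  shows "p' \<in> pos_polys \<Lambda>" "q' \<in> pos_polys \<Lambda>"
proof -
  define Pt Qt where "Pt t \<theta> = (1 - t) * ev p' \<theta> + t" and "Qt t \<theta> = (1 - t) * ev q' \<theta> + t" for t \<theta>
  obtain N where N: "\<And>\<theta>. ev p' \<theta> \<le> N" "\<And>\<theta>. ev q' \<theta> \<le> N"
  proof
    show "ev p' \<theta> \<le> max (\<Sum>k\<in>\<Lambda>. norm (p' k)) (\<Sum>k\<in>\<Lambda>. norm (q' k))" for \<theta>
      using abs_trig_eval_le[of \<Lambda> p' \<theta>] by linarith
    show "ev q' \<theta> \<le> max (\<Sum>k\<in>\<Lambda>. norm (p' k)) (\<Sum>k\<in>\<Lambda>. norm (q' k))" for \<theta>
      using abs_trig_eval_le[of \<Lambda> q' \<theta>] by linarith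
  qed
  define C where "C = 1 + N * N + 2 * (N + 1) + 2 * lam + (2 * ln 2 - 2 - ln lam)"
  define A where "A = coeff_inner \<Lambda> c (\<lambda>k. unit_coeffs k - q' k) - coeff_inner \<Lambda> \<gamma> (\<lambda>k. unit_coeffs k - p' k)"
  have Pt_pos: "Pt t \<theta> > 0" and Qt_pos: "Qt t \<theta> > 0"
    and Pt_le: "Pt t \<theta> \<le> ev p' \<theta> + t" and Qt_le: "Qt t \<theta> \<le> ev q' \<theta> + t"
    if "0 < t" "t \<le> 1 / 2" for t \<theta>
    using that p'(2)[of \<theta>] q'(2)[of \<theta>] unfolding Pt_def Qt_def
    by (auto intro: add_nonneg_pos mult_left_le_one_le)
  have cont: "continuous_on UNIV (Pt t)" "continuous_on UNIV (Qt t)" for t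
    unfolding Pt_def Qt_def by (intro continuous_intros)+
  have cont_quot: "continuous_on UNIV (\<lambda>\<theta>. Pt t \<theta> / Qt t \<theta>)" "continuous_on UNIV (\<lambda>\<theta>. lam / Pt t \<theta>)"
    if "0 < t" "t \<le> 1 / 2" for t
    using Pt_pos[OF that] Qt_pos[OF that]
    by (auto intro!: continuous_intros cont simp: less_imp_neq[symmetric])
  \<comment> \<open>The factor 2 reflects that only half of the singular terms remains after the
    logarithm has been absorbed.\<close>
  have bound: "torus_integral (\<lambda>\<theta>. Pt t \<theta> / Qt t \<theta>) + torus_integral (\<lambda>\<theta>. lam / Pt t \<theta>) \<le> 2 * (A + C)"
    if t: "0 < t" "t \<le> 1 / 2" for t
  proof -
    define E where "E \<theta> = entropy_deriv lam (Pt t \<theta>) (Qt t \<theta>) (1 - ev p' \<theta>) (1 - ev q' \<theta>)" for \<theta>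
    have "- A \<le> torus_integral E"
      using nonneg[OF t] unfolding grad_def trig_eval_lincomb trig_eval_diff trig_eval_unit_coeffs[OF index_set]
        A_def[symmetric] E_def[symmetric] Pt_def[symmetric] Qt_def[symmetric] mult_1_right
      by (simp add: E_def[abs_def] Pt_def Qt_def A_def)
    also have "torus_integral E \<le>
        torus_integral (\<lambda>\<theta>. C - (1 / 2) * (Pt t \<theta> / Qt t \<theta> + lam / Pt t \<theta>))"
    proof (rule torus_integral_mono)
      show "E \<theta> \<le> C - (1 / 2) * (Pt t \<theta> / Qt t \<theta> + lam / Pt t \<theta>)" for \<theta>
        using entropy_deriv_towards_one_le[OF t p'(2) N(1) q'(2) N(2) lam_pos, of \<theta> \<theta>]
        by (simp add: E_def C_def Pt_def Qt_def)
      show "continuous_on UNIV E"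
        unfolding E_def by (intro continuous_intros cont Pt_pos Qt_pos t)
    qed (intro continuous_intros cont_quot t)
    also have "\<dots> = C - (1 / 2) * (torus_integral (\<lambda>\<theta>. Pt t \<theta> / Qt t \<theta>) + torus_integral (\<lambda>\<theta>. lam / Pt t \<theta>))"
      using cont_quot[OF t]
      by (simp only: torus_integral_diff torus_integral_add torus_integral_mult_right torus_integral_const
          continuous_on_const continuous_on_mult_left continuous_on_add)
    finally show ?thesis
      by argo
  qed
  have quot_nonneg: "torus_integral (\<lambda>\<theta>. Pt t \<theta> / Qt t \<theta>) \<ge> 0" "torus_integral (\<lambda>\<theta>. lam / Pt t \<theta>) \<ge> 0"
    if t: "0 < t" "t \<le> 1 / 2" for t
    using torus_integral_mono[OF continuous_on_const cont_quot(1)[OF t], of 0]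
      torus_integral_mono[OF continuous_on_const cont_quot(2)[OF t], of 0] Pt_pos[OF t] Qt_pos[OF t] lam_pos
    by (simp_all add: less_imp_le)
  have cont_inv: "continuous_on UNIV (\<lambda>\<theta>. 1 / (ev a \<theta> + t))" if "t > 0" "\<And>\<theta>. ev a \<theta> \<ge> 0" for t a
  proof (intro continuous_intros ballI)
    show "ev a \<theta> + t \<noteq> 0" for \<theta>
      using that(2)[of \<theta>] that(1) by linarith
  qed
  show p'_pos: "p' \<in> pos_polys \<Lambda>"
  proof (rule ccontr)
    assume "p' \<notin> pos_polys \<Lambda>"
    then obtain \<theta>0 where "\<theta>0 \<in> torus" "ev p' \<theta>0 = 0"
      using pos_polys_closed_no_zero p' by metis
    then obtain t where t: "0 < t" "t \<le> 1 / 2"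
      and big: "torus_integral (\<lambda>\<theta>. 1 / (ev p' \<theta> + t)) > 2 * (A + C) / lam"
      using torus_integral_inverse_unbounded[OF dim p'(2)] by metis
    have "lam * torus_integral (\<lambda>\<theta>. 1 / (ev p' \<theta> + t)) = torus_integral (\<lambda>\<theta>. lam * (1 / (ev p' \<theta> + t)))"
      by (rule torus_integral_mult_right[symmetric])
    also have "\<dots> \<le> torus_integral (\<lambda>\<theta>. lam / Pt t \<theta>)"
    proof (rule torus_integral_mono)
      fix \<theta>
      show "lam * (1 / (ev p' \<theta> + t)) \<le> lam / Pt t \<theta>"
        using Pt_pos[OF t, of \<theta>] Pt_le[OF t, of \<theta>] lam_pos by (simp add: divide_left_mono)
    qed (intro continuous_intros cont_inv cont_quot t p')+
    also have "\<dots> \<le> 2 * (A + C)"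
      using bound[OF t] quot_nonneg[OF t] by linarith
    finally show False
      using big lam_pos by (simp add: field_simps)
  qed
  obtain \<mu> where \<mu>: "\<mu> > 0" "\<And>\<theta>. \<mu> \<le> ev p' \<theta>"
    using pos_polys_lower_bound[OF p'_pos] by metis
  show "q' \<in> pos_polys \<Lambda>"
  proof (rule ccontr)
    assume "q' \<notin> pos_polys \<Lambda>"
    then obtain \<theta>0 where "\<theta>0 \<in> torus" "ev q' \<theta>0 = 0"
      using pos_polys_closed_no_zero q' by metis
    then obtain t where t: "0 < t" "t \<le> 1 / 2"
      and big: "torus_integral (\<lambda>\<theta>. 1 / (ev q' \<theta> + t)) > 2 * (A + C) / (\<mu> / 2)"
      using torus_integral_inverse_unbounded[OF dim q'(2)] by metis
    have "\<mu> / 2 * torus_integral (\<lambda>\<theta>. 1 / (ev q' \<theta> + t)) = torus_integral (\<lambda>\<theta>. \<mu> / 2 * (1 / (ev q' \<theta> + t)))"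
      by (rule torus_integral_mult_right[symmetric])
    also have "\<dots> \<le> torus_integral (\<lambda>\<theta>. Pt t \<theta> / Qt t \<theta>)"
    proof (rule torus_integral_mono)
      fix \<theta>
      \<comment> \<open>Since \<open>t \<le> 1 / 2\<close>, at least half of the lower bound of
        \<open>P'\<close> survives in \<open>Pt\<close>.\<close>
      have "1 / 2 * \<mu> \<le> (1 - t) * ev p' \<theta>"
        using t \<mu>(1) \<mu>(2)[of \<theta>] by (intro mult_mono) auto
      then have "\<mu> / 2 \<le> Pt t \<theta>"
        unfolding Pt_def using t by linarith
      moreover have "1 / (ev q' \<theta> + t) \<le> 1 / Qt t \<theta>"
        using Qt_pos[OF t, of \<theta>] Qt_le[OF t, of \<theta>] by (simp add: divide_left_mono)
      ultimately have "\<mu> / 2 * (1 / (ev q' \<theta> + t)) \<le> Pt t \<theta> * (1 / Qt t \<theta>)"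
        using \<mu>(1) q'(2)[of \<theta>] t by (intro mult_mono) auto
      then show "\<mu> / 2 * (1 / (ev q' \<theta> + t)) \<le> Pt t \<theta> / Qt t \<theta>"
        by simp
    qed (intro continuous_intros cont_inv cont_quot t q')+
    also have "\<dots> \<le> 2 * (A + C)"
      using bound[OF t] quot_nonneg[OF t] by linarith
    finally show False
      using big \<mu>(1) by (simp add: field_simps)
  qed
qed

text \<open>The tangent at the interior limit replaces lower semicontinuity of \<open>J\<close>:
  along the sequence the linear term tends to zero, so the value at the limit is at most the
  infimum.\<close>

lemma minimiser_exists:
  assumes "CARD('d) \<le> 2"
  obtains x where "is_arg_min J (\<lambda>x. x \<in> feasible \<Lambda>) x"
proof -
  obtain p q p' q' where seq: "\<And>n. (p n, q n) \<in> feasible \<Lambda>" "(\<lambda>n. J (p n, q n)) \<longlonglongrightarrow> Inf (J ` feasible \<Lambda>)"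
    "\<And>k. (\<lambda>n. p n k) \<longlonglongrightarrow> p' k" "\<And>k. (\<lambda>n. q n k) \<longlonglongrightarrow> q' k"
    and p': "p' \<in> trig_polys \<Lambda>" "p' 0 = 1" "\<And>\<theta>. ev p' \<theta> \<ge> 0"
    and q': "q' \<in> trig_polys \<Lambda>" "\<And>\<theta>. ev q' \<theta> \<ge> 0"
    using minimising_sequence by blast
  note pos' = limit_of_minimising_sequence_positive[OF assms p'(1,3) q' grad_towards_unit_nonneg[OF seq]]
  obtain m1 m2 where m: "m1 > 0" "\<And>\<theta>. m1 \<le> ev p' \<theta>" "m2 > 0" "\<And>\<theta>. m2 \<le> ev q' \<theta>"
    using pos_polys_lower_bound[OF pos'(1)] pos_polys_lower_bound[OF pos'(2)] by metis
  have "(\<lambda>n. grad p' q' (\<lambda>k. p n k - p' k) (\<lambda>k. q n k - q' k)) \<longlonglongrightarrow>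
      grad p' q' (\<lambda>k. p' k - p' k) (\<lambda>k. q' k - q' k)"
    using m by (intro tendsto_grad[of _ _ _ _ _ _ _ _ "min m1 m2"] tendsto_intros seq) (auto simp: min.coboundedI1 min.coboundedI2)
  moreover have "grad p' q' (\<lambda>k. p' k - p' k) (\<lambda>k. q' k - q' k) = 0"
    by (simp add: grad_def coeff_inner_def trig_eval_def entropy_deriv_def)
  ultimately have G: "(\<lambda>n. grad p' q' (\<lambda>k. p n k - p' k) (\<lambda>k. q n k - q' k)) \<longlonglongrightarrow> 0"
    by simp
  have "J (p', q') + grad p' q' (\<lambda>k. p n k - p' k) (\<lambda>k. q n k - q' k) \<le> J (p n, q n)" for n
    using seq(1)[of n] by (intro objective_above_tangent pos') (auto simp: feasible_iff)
  then have "J (p', q') + 0 \<le> Inf (J ` feasible \<Lambda>)"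
    by (intro LIMSEQ_le[OF tendsto_add[OF tendsto_const G] seq(2)]) auto
  moreover have "Inf (J ` feasible \<Lambda>) \<le> J x" if "x \<in> feasible \<Lambda>" for x
    using that by (intro cInf_lower bdd_below_objective) auto
  ultimately have "is_arg_min J (\<lambda>x. x \<in> feasible \<Lambda>) (p', q')"
    using pos' p'(2) by (force simp: is_arg_min_def feasible_iff)
  then show thesis
    by (rule that)
qed

subsection \<open>Strict convexity and stationarity\<close>

text \<open>The tangent at the intermediate point is compared with both endpoints. Its increments
  there are \<open>t * g\<close> and \<open>(t - 1) * g\<close>, which cancel in the weighted sum;
  strictness at one endpoint is enough.\<close>

lemma strictly_convex: "strictly_convex_problem (feasible \<Lambda>) J"
  unfolding strictly_convex_problem_def
proof (intro ballI allI impI conjI)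
  fix x y t
  assume xy: "x \<in> feasible \<Lambda>" "y \<in> feasible \<Lambda>" and t: "0 < (t :: real) \<and> t < 1"
  obtain p q where x: "x = (p, q)"
    by (cases x)
  obtain p' q' where y: "y = (p', q')"
    by (cases y)
  define P where "P = (\<lambda>k. (1 - t) *\<^sub>R p k + t *\<^sub>R p' k)"
  define Q where "Q = (\<lambda>k. (1 - t) *\<^sub>R q k + t *\<^sub>R q' k)"
  have comb: "convex_comb t x y = (P, Q)"
    by (simp add: convex_comb_def x y P_def Q_def)
  have pos: "p \<in> pos_polys \<Lambda>" "p 0 = 1" "q \<in> pos_polys \<Lambda>" "p' \<in> pos_polys \<Lambda>" "p' 0 = 1" "q' \<in> pos_polys \<Lambda>"
    using xy by (auto simp: x y feasible_iff)
  have PQ: "P \<in> pos_polys \<Lambda>" "Q \<in> pos_polys \<Lambda>"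
    unfolding P_def Q_def using t pos by (auto intro!: pos_polys_lincomb)
  moreover have "P 0 = 1"
    by (simp add: P_def pos scaleR_conv_of_real flip: of_real_add)
  ultimately show "convex_comb t x y \<in> feasible \<Lambda>"
    by (simp add: comb feasible_iff)
  assume "x \<noteq> y"
  define g where "g = grad P Q (\<lambda>k. p k - p' k) (\<lambda>k. q k - q' k)"
  have scale: "grad P Q (\<lambda>k. s *\<^sub>R (p k - p' k)) (\<lambda>k. s *\<^sub>R (q k - q' k)) = s * g" for s
    using grad_lincomb[OF PQ, of s "\<lambda>k. p k - p' k" 0 "\<lambda>k. p k - p' k" "\<lambda>k. q k - q' k" "\<lambda>k. q k - q' k"]
    by (simp add: g_def)
  have diff: "(\<lambda>k. p k - P k) = (\<lambda>k. t *\<^sub>R (p k - p' k))" "(\<lambda>k. q k - Q k) = (\<lambda>k. t *\<^sub>R (q k - q' k))"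
    "(\<lambda>k. p' k - P k) = (\<lambda>k. (t - 1) *\<^sub>R (p k - p' k))" "(\<lambda>k. q' k - Q k) = (\<lambda>k. (t - 1) *\<^sub>R (q k - q' k))"
    by (simp_all add: P_def Q_def algebra_simps)
  have "p \<noteq> P \<or> q \<noteq> Q"
  proof (rule ccontr)
    assume "\<not> (p \<noteq> P \<or> q \<noteq> Q)"
    with diff have "\<And>k. t *\<^sub>R (p k - p' k) = 0" "\<And>k. t *\<^sub>R (q k - q' k) = 0"
      by (metis diff_self)+
    with t \<open>x \<noteq> y\<close> show False
      by (auto simp: x y)
  qed
  then have "J (P, Q) + t * g < J (p, q)"
    using objective_above_tangent[OF PQ pos(1,3)] unfolding diff scale by fastforce
  moreover have "J (P, Q) + (t - 1) * g \<le> J (p', q')"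
    using objective_above_tangent(1)[OF PQ pos(4,6)] unfolding diff scale .
  ultimately have "(1 - t) * (J (P, Q) + t * g) + t * (J (P, Q) + (t - 1) * g) < (1 - t) * J x + t * J y"
    using t by (intro add_less_le_mono mult_strict_left_mono mult_left_mono) (auto simp: x y)
  then show "J (convex_comb t x y) < (1 - t) * J x + t * J y"
    by (simp add: comb algebra_simps)
qed

lemma minimiser_unique:
  assumes "is_arg_min J (\<lambda>x. x \<in> feasible \<Lambda>) x" "is_arg_min J (\<lambda>x. x \<in> feasible \<Lambda>) y"
  shows "x = y"
proof (rule ccontr)
  assume "x \<noteq> y"
  have le: "J x \<le> J z" "J y \<le> J z" if "z \<in> feasible \<Lambda>" for z
    using assms that unfolding is_arg_min_linorder by blast+
  have in_feas: "x \<in> feasible \<Lambda>" "y \<in> feasible \<Lambda>"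
    using assms by (auto simp: is_arg_min_def)
  then have "J x = J y"
    using le[of x] le[of y] by simp
  moreover have "convex_comb t x y \<in> feasible \<Lambda>" "J (convex_comb t x y) < (1 - t) * J x + t * J y"
    if "0 < t" "t < 1" for t
    using strictly_convex in_feas \<open>x \<noteq> y\<close> that unfolding strictly_convex_problem_def by blast+
  from this[of "1 / 2"] have "convex_comb (1 / 2) x y \<in> feasible \<Lambda>"
    "J (convex_comb (1 / 2) x y) < (1 - 1 / 2) * J x + 1 / 2 * J y"
    by simp_all
  ultimately show False
    using le(1)[of "convex_comb (1 / 2) x y"] by simp
qed

text \<open>The tangent is taken at slightly perturbed points and compared with the minimiser.
  Minimality makes the slope nonnegative at each of them, and continuity of \<open>grad\<close>
  transfers the sign.\<close>

lemma grad_at_minimiser_nonneg: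
  assumes min: "is_arg_min J (\<lambda>x. x \<in> feasible \<Lambda>) (p, q)"
    and uv: "u \<in> trig_polys \<Lambda>" "u 0 = 0" "v \<in> trig_polys \<Lambda>"
  shows "grad p q u v \<ge> 0"
proof -
  have pos: "p \<in> pos_polys \<Lambda>" "p 0 = 1" "q \<in> pos_polys \<Lambda>"
    using min by (auto simp: is_arg_min_def feasible_iff)
  obtain m1 m2 where m12: "m1 > 0" "\<And>\<theta>. m1 \<le> ev p \<theta>" "m2 > 0" "\<And>\<theta>. m2 \<le> ev q \<theta>"
    using pos_polys_lower_bound[OF pos(1)] pos_polys_lower_bound[OF pos(3)] by metis
  define m where "m = min m1 m2"
  have m: "m > 0" "\<And>\<theta>. m \<le> ev p \<theta>" "\<And>\<theta>. m \<le> ev q \<theta>"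
    using m12 by (auto simp: m_def min.coboundedI1 min.coboundedI2)
  \<comment> \<open>The summand 1 keeps \<open>M\<close> positive when both directions
    vanish.\<close>
  define M where "M = 1 + (\<Sum>k\<in>\<Lambda>. norm (u k)) + (\<Sum>k\<in>\<Lambda>. norm (v k))"
  have M: "M > 0" "\<bar>ev u \<theta>\<bar> \<le> M" "\<bar>ev v \<theta>\<bar> \<le> M" for \<theta>
    unfolding M_def using abs_trig_eval_le[of \<Lambda> u \<theta>] abs_trig_eval_le[of \<Lambda> v \<theta>]
      sum_nonneg[of \<Lambda> "\<lambda>k. norm (u k)"] sum_nonneg[of \<Lambda> "\<lambda>k. norm (v k)"] by auto
  \<comment> \<open>The perturbation has size at most \<open>m / 2\<close>, so the perturbed
    polynomials keep the lower bound \<open>m / 2\<close>.\<close>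
  define t where "t n = m / (2 * M) * (1 / real (Suc n))" for n
  have t_pos: "t n > 0" for n
    using m M by (simp add: t_def)
  have t_small: "t n * M \<le> m / 2" for n
  proof -
    have "t n * M = m / 2 * (1 / real (Suc n))"
      using M(1) by (simp add: t_def)
    also have "\<dots> \<le> m / 2 * 1"
      using m(1) by (intro mult_left_mono) auto
    finally show ?thesis
      by simp
  qed
  have "t \<longlonglongrightarrow> m / (2 * M) * 0"
    unfolding t_def using LIMSEQ_inverse_real_of_nat
    by (intro tendsto_mult tendsto_const) (simp add: inverse_eq_divide)
  then have t_lim: "t \<longlonglongrightarrow> 0"
    by simp
  define S where "S n a b = (\<lambda>k. 1 *\<^sub>R a k + t n *\<^sub>R b k)" for n and a b :: "int ^ 'd \<Rightarrow> complex"
  have lower: "m / 2 \<le> ev (S n a b) \<theta>" if "\<And>\<theta>. m \<le> ev a \<theta>" "\<And>\<theta>. \<bar>ev b \<theta>\<bar> \<le> M" for n a b \<theta>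
  proof -
    have "t n * ev b \<theta> \<ge> t n * (- M)"
      using that(2)[of \<theta>] t_pos[of n] by (intro mult_left_mono) auto
    with t_small[of n] have "t n * ev b \<theta> \<ge> - (m / 2)"
      by simp
    then show ?thesis
      unfolding S_def trig_eval_lincomb using that(1)[of \<theta>] by simp
  qed
  have S_pos: "S n a b \<in> pos_polys \<Lambda>"
    if "a \<in> trig_polys \<Lambda>" "b \<in> trig_polys \<Lambda>" "\<And>\<theta>. m \<le> ev a \<theta>" "\<And>\<theta>. \<bar>ev b \<theta>\<bar> \<le> M" for n a b
    using lower[OF that(3,4), of n] m(1) trig_polys_lincomb[OF that(1,2), of 1 "t n"]
    by (force simp: pos_polys_def S_def intro: less_le_trans[of 0 "m / 2"])
  have S_p: "S n p u \<in> pos_polys \<Lambda>" "m / 2 \<le> ev (S n p u) \<theta>"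
    and S_q: "S n q v \<in> pos_polys \<Lambda>" "m / 2 \<le> ev (S n q v) \<theta>" for n \<theta>
    by (rule S_pos lower; use m M uv pos in \<open>auto intro: pos_polysD\<close>)+
  have nonneg: "grad (S n p u) (S n q v) u v \<ge> 0" for n
  proof -
    have "(S n p u, S n q v) \<in> feasible \<Lambda>"
      using S_p(1) S_q(1) by (simp add: feasible_iff) (simp add: S_def pos uv)
    then have "J (p, q) \<le> J (S n p u, S n q v)"
      using min by (auto simp: is_arg_min_linorder)
    moreover have "J (S n p u, S n q v) + grad (S n p u) (S n q v) (\<lambda>k. p k - S n p u k) (\<lambda>k. q k - S n q v k) \<le> J (p, q)"
      by (intro objective_above_tangent S_p S_q pos)
    moreover have "grad (S n p u) (S n q v) (\<lambda>k. p k - S n p u k) (\<lambda>k. q k - S n q v k) =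
        grad (S n p u) (S n q v) (\<lambda>k. (- t n) *\<^sub>R u k + 0 *\<^sub>R u k) (\<lambda>k. (- t n) *\<^sub>R v k + 0 *\<^sub>R v k)"
      by (simp add: S_def)
    moreover have "\<dots> = - t n * grad (S n p u) (S n q v) u v"
      by (subst grad_lincomb[OF S_p(1) S_q(1)]) simp
    ultimately have "t n * grad (S n p u) (S n q v) u v \<ge> 0"
      by simp
    with t_pos[of n] show ?thesis
      by (simp add: zero_le_mult_iff)
  qed
  have S_lim: "(\<lambda>n. S n a b k) \<longlonglongrightarrow> a k" for a b k
  proof -
    have "(\<lambda>n. S n a b k) \<longlonglongrightarrow> 1 *\<^sub>R a k + 0 *\<^sub>R b k"
      unfolding S_def by (intro tendsto_intros t_lim)
    then show ?thesis
      by simp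
  qed
  have "(\<lambda>n. grad (S n p u) (S n q v) u v) \<longlonglongrightarrow> grad p q u v"
    using m(1) by (intro tendsto_grad[of _ _ _ _ _ _ _ _ "m / 2"] S_lim S_p S_q tendsto_const) simp
  then show ?thesis
    by (rule LIMSEQ_le_const) (use nonneg in blast)
qed

lemma grad_at_minimiser_eq_0:
  assumes min: "is_arg_min J (\<lambda>x. x \<in> feasible \<Lambda>) (p, q)"
    and uv: "u \<in> trig_polys \<Lambda>" "u 0 = 0" "v \<in> trig_polys \<Lambda>"
  shows "grad p q u v = 0"
proof -
  have pos: "p \<in> pos_polys \<Lambda>" "q \<in> pos_polys \<Lambda>"
    using min by (auto simp: is_arg_min_def feasible_iff)
  have "grad p q (\<lambda>k. (- 1) *\<^sub>R u k + 0 *\<^sub>R u k) (\<lambda>k. (- 1) *\<^sub>R v k + 0 *\<^sub>R v k) \<ge> 0"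
    using uv by (intro grad_at_minimiser_nonneg[OF min] trig_polys_lincomb) auto
  then have "grad p q u v \<le> 0"
    by (subst (asm) grad_lincomb[OF pos]) simp
  with grad_at_minimiser_nonneg[OF min uv] show ?thesis
    by simp
qed

subsection \<open>Moment matching\<close>

text \<open>Coefficients of the real part of a single character with complex amplitude. Adding the
  two cases instead of nesting them makes \<open>k = 0\<close> give the constant
  \<open>2 * Re z\<close>, so the formulas below hold for all \<open>k\<close>.\<close>

definition harmonic :: "complex \<Rightarrow> int ^ 'd \<Rightarrow> int ^ 'd \<Rightarrow> complex" where
  "harmonic z k j = (if j = k then z else 0) + (if j = - k then cnj z else 0)"

lemma uminus_index: "k \<in> \<Lambda> \<Longrightarrow> - k \<in> \<Lambda>"
  using index_set by (auto simp: index_set_def)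

lemma harmonic_trig_polys: "k \<in> \<Lambda> \<Longrightarrow> harmonic z k \<in> trig_polys \<Lambda>"
  using uminus_index[of k] by (auto simp: trig_polys_def hermitian_on_def harmonic_def minus_equation_iff)

lemma sum_harmonic:
  fixes f :: "int ^ 'd \<Rightarrow> complex"
  assumes "k \<in> \<Lambda>"
  shows "(\<Sum>j\<in>\<Lambda>. f j * harmonic z k j) = f k * z + f (- k) * cnj z"
  using assms uminus_index[OF assms] finite_index
  by (simp add: harmonic_def distrib_left sum.distrib if_distrib[of "\<lambda>x. _ * x"] cong: if_cong)

lemma trig_eval_harmonic:
  assumes "k \<in> \<Lambda>"
  shows "ev (harmonic z k) \<theta> = 2 * Re (cnj z * cis (pairing k \<theta>))"
  using sum_harmonic[OF assms, of "\<lambda>j. cis (- pairing j \<theta>)" z]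
  by (simp add: trig_eval_def mult.commute pairing_minus)

lemma coeff_inner_harmonic:
  assumes "k \<in> \<Lambda>" "a (- k) = cnj (a k)"
  shows "coeff_inner \<Lambda> a (harmonic z k) = 2 * Re (cnj z * a k)"
proof -
  have "(\<Sum>j\<in>\<Lambda>. a j * cnj (harmonic z k j)) = (\<Sum>j\<in>\<Lambda>. a j * harmonic (cnj z) k j)"
    by (rule sum.cong) (simp_all add: harmonic_def)
  also have "\<dots> = a k * cnj z + a (- k) * z"
    using sum_harmonic[OF assms(1), of a "cnj z"] by simp
  finally show ?thesis
    using assms(2) by (simp add: coeff_inner_def)
qed

lemma torus_integral_mult_harmonic:
  assumes "k \<in> \<Lambda>" "continuous_on UNIV f"
  shows "torus_integral (\<lambda>\<theta>. f \<theta> * ev (harmonic z k) \<theta>) =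
    2 * Re (cnj z * torus_integral (\<lambda>\<theta>. cis (pairing k \<theta>) * of_real (f \<theta>)))"
proof -
  have "torus_integral (\<lambda>\<theta>. f \<theta> * ev (harmonic z k) \<theta>) =
      torus_integral (\<lambda>\<theta>. Re (2 * cnj z * (cis (pairing k \<theta>) * of_real (f \<theta>))))"
    by (rule arg_cong[where f = torus_integral]) (auto simp: trig_eval_harmonic[OF assms(1)] algebra_simps)
  also have "\<dots> = Re (2 * cnj z * torus_integral (\<lambda>\<theta>. cis (pairing k \<theta>) * of_real (f \<theta>)))"
    using assms(2) by (subst torus_integral_Re) (auto intro!: continuous_intros simp: torus_integral_mult_right)
  finally show ?thesis
    by simp
qed

text \<open>Stationarity gives one real equation per amplitude \<open>z\<close>; the amplitudes 1
  and \<open>\<i>\<close> recover the complex moment equation.\<close>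

lemma complex_eqI_Re_mult:
  assumes "\<And>z. Re (cnj z * a) = Re (cnj z * b)"
  shows "a = b"
  using assms[of 1] assms[of \<i>] by (simp add: complex_eq_iff)

text \<open>Varying \<open>q\<close> alone yields the covariances, including \<open>k = 0\<close>.
  Varying \<open>p\<close> alone yields the cepstral equations; the normalisation admits only
  harmonics with \<open>k \<noteq> 0\<close> there.\<close>

lemma moment_matching:
  assumes min: "is_arg_min J (\<lambda>x. x \<in> feasible \<Lambda>) (p, q)" and k: "k \<in> \<Lambda>"
  shows "c k = torus_integral (\<lambda>\<theta>. cis (pairing k \<theta>) * of_real (ev p \<theta> / ev q \<theta>))"
    and "k \<noteq> 0 \<Longrightarrow> \<gamma> k + of_real lam * torus_integral (\<lambda>\<theta>. cis (pairing k \<theta>) * of_real (inverse (ev p \<theta>))) =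
      torus_integral (\<lambda>\<theta>. cis (pairing k \<theta>) * of_real (ln (ev p \<theta> / ev q \<theta>)))"
proof -
  have pos: "p \<in> pos_polys \<Lambda>" "q \<in> pos_polys \<Lambda>"
    using min by (auto simp: is_arg_min_def feasible_iff)
  have neq: "ev p \<theta> \<noteq> 0" "ev q \<theta> \<noteq> 0" for \<theta>
    using pos_polysD(2)[OF pos(1), of \<theta>] pos_polysD(2)[OF pos(2), of \<theta>] by auto
  have cont: "continuous_on UNIV (\<lambda>\<theta>. ev p \<theta> / ev q \<theta>)" "continuous_on UNIV (\<lambda>\<theta>. ln (ev p \<theta> / ev q \<theta>))"
    "continuous_on UNIV (\<lambda>\<theta>. inverse (ev p \<theta>))"
    using neq by (auto intro!: continuous_intros)
  have zero: "(\<lambda>_. 0) \<in> trig_polys \<Lambda>" "ev (\<lambda>_. 0) \<theta> = 0" "coeff_inner \<Lambda> a (\<lambda>_. 0) = 0" for a \<theta>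
    by (simp_all add: trig_polys_def hermitian_on_def trig_eval_def coeff_inner_def)
  show "c k = torus_integral (\<lambda>\<theta>. cis (pairing k \<theta>) * of_real (ev p \<theta> / ev q \<theta>))"
  proof (rule complex_eqI_Re_mult)
    fix z
    have "c (- k) = cnj (c k)"
      using c_dual k by (simp add: pos_dual_def hermitian_on_def)
    note c_inner = coeff_inner_harmonic[OF k, of c z, OF this]
    have "0 = grad p q (\<lambda>_. 0) (harmonic z k)"
      using grad_at_minimiser_eq_0[OF min zero(1) _ harmonic_trig_polys[OF k]] by simp
    also have "\<dots> = 2 * Re (cnj z * c k)
        + torus_integral (\<lambda>\<theta>. (- 1) * (ev p \<theta> / ev q \<theta> * ev (harmonic z k) \<theta>))"
      by (simp add: grad_def zero c_inner entropy_deriv_def)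
    also have "\<dots> = 2 * Re (cnj z * c k)
        - 2 * Re (cnj z * torus_integral (\<lambda>\<theta>. cis (pairing k \<theta>) * of_real (ev p \<theta> / ev q \<theta>)))"
      by (simp only: torus_integral_mult_right torus_integral_mult_harmonic[OF k cont(1)])
    finally show "Re (cnj z * c k) = Re (cnj z * torus_integral (\<lambda>\<theta>. cis (pairing k \<theta>) * of_real (ev p \<theta> / ev q \<theta>)))"
      by simp
  qed
  assume "k \<noteq> 0"
  let ?L = "torus_integral (\<lambda>\<theta>. cis (pairing k \<theta>) * of_real (ln (ev p \<theta> / ev q \<theta>)))"
  let ?I = "torus_integral (\<lambda>\<theta>. cis (pairing k \<theta>) * of_real (inverse (ev p \<theta>)))"
  show "\<gamma> k + of_real lam * ?I = ?L"
  proof (rule complex_eqI_Re_mult)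
    fix z
    have h0: "harmonic z k 0 = 0"
      using \<open>k \<noteq> 0\<close> by (simp add: harmonic_def)
    have "\<gamma> (- k) = cnj (\<gamma> k)"
      using gamma_hermitian k \<open>k \<noteq> 0\<close> by (simp add: hermitian_on_def)
    note g_inner = coeff_inner_harmonic[OF k, of \<gamma> z, OF this]
    have "0 = grad p q (harmonic z k) (\<lambda>_. 0)"
      using grad_at_minimiser_eq_0[OF min harmonic_trig_polys[OF k] h0 zero(1)] by simp
    also have "\<dots> = - 2 * Re (cnj z * \<gamma> k)
        + torus_integral (\<lambda>\<theta>. ln (ev p \<theta> / ev q \<theta>) * ev (harmonic z k) \<theta> + ev (harmonic z k) \<theta>
            - lam * (inverse (ev p \<theta>) * ev (harmonic z k) \<theta>))"
      by (simp add: grad_def zero g_inner entropy_deriv_def algebra_simps divide_inverse)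
    also have "torus_integral (\<lambda>\<theta>. ln (ev p \<theta> / ev q \<theta>) * ev (harmonic z k) \<theta> + ev (harmonic z k) \<theta>
            - lam * (inverse (ev p \<theta>) * ev (harmonic z k) \<theta>)) =
        torus_integral (\<lambda>\<theta>. ln (ev p \<theta> / ev q \<theta>) * ev (harmonic z k) \<theta>) + torus_integral (ev (harmonic z k))
          - lam * torus_integral (\<lambda>\<theta>. inverse (ev p \<theta>) * ev (harmonic z k) \<theta>)"
    proof -
      have "continuous_on UNIV (\<lambda>\<theta>. ln (ev p \<theta> / ev q \<theta>) * ev (harmonic z k) \<theta>)"
        "continuous_on UNIV (ev (harmonic z k))" "continuous_on UNIV (\<lambda>\<theta>. inverse (ev p \<theta>) * ev (harmonic z k) \<theta>)"
        by (intro continuous_on_mult cont continuous_on_trig_eval)+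
      then show ?thesis
        by (simp only: torus_integral_diff torus_integral_add torus_integral_mult_right
            continuous_on_add continuous_on_mult_left)
    qed
    \<comment> \<open>The middle integral comes from the summand 1 in \<open>entropy_deriv\<close>;
      it vanishes because a harmonic with \<open>k \<noteq> 0\<close> has mean zero.\<close>
    also have "\<dots> = 2 * Re (cnj z * ?L) - lam * (2 * Re (cnj z * ?I))"
      by (simp only: torus_integral_mult_harmonic[OF k cont(2)] torus_integral_mult_harmonic[OF k cont(3)]
          torus_integral_trig_eval[OF index_set harmonic_trig_polys[OF k]] h0) simp
    finally have "0 = - 2 * Re (cnj z * \<gamma> k) + (2 * Re (cnj z * ?L) - lam * (2 * Re (cnj z * ?I)))" .
    moreover have "g + lam * i = l" if "0 = - 2 * g + (2 * l - lam * (2 * i))" for g i l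
      using that by (simp add: algebra_simps)
    ultimately have "Re (cnj z * \<gamma> k) + lam * Re (cnj z * ?I) = Re (cnj z * ?L)"
      by blast
    moreover have "Re (cnj z * (\<gamma> k + of_real lam * ?I)) = Re (cnj z * \<gamma> k) + lam * Re (cnj z * ?I)"
      by (simp add: algebra_simps)
    ultimately show "Re (cnj z * (\<gamma> k + of_real lam * ?I)) = Re (cnj z * ?L)"
      by simp
  qed
qed

end

theorem theorem5p7:
  fixes \<Lambda> :: "(int ^ 'd) set" and c \<gamma> :: "int ^ 'd \<Rightarrow> complex" and lam :: real
  assumes "CARD('d) \<le> 2"
    and "index_set \<Lambda>"
    and "hermitian_on (\<Lambda> - {0}) \<gamma>" and "\<gamma> 0 = 1"
    and "c \<in> pos_dual \<Lambda>"
    and "lam > 0"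
  shows "strictly_convex_problem (feasible \<Lambda>) (objective \<Lambda> c \<gamma> lam)
    \<and> (\<exists>!x. is_arg_min (objective \<Lambda> c \<gamma> lam) (\<lambda>x. x \<in> feasible \<Lambda>) x)
    \<and> (\<forall>p q. is_arg_min (objective \<Lambda> c \<gamma> lam) (\<lambda>x. x \<in> feasible \<Lambda>) (p, q) \<longrightarrow>
        (let \<Phi> = (\<lambda>\<theta>. trig_eval \<Lambda> p \<theta> / trig_eval \<Lambda> q \<theta>);
             \<epsilon> = (\<lambda>k. of_real lam *
                     torus_integral (\<lambda>\<theta>. cis (pairing k \<theta>) * of_real (inverse (trig_eval \<Lambda> p \<theta>))))
         in (\<forall>k\<in>\<Lambda>. c k = torus_integral (\<lambda>\<theta>. cis (pairing k \<theta>) * of_real (\<Phi> \<theta>)))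
          \<and> (\<forall>k\<in>\<Lambda> - {0}. \<gamma> k + \<epsilon> k =
                torus_integral (\<lambda>\<theta>. cis (pairing k \<theta>) * of_real (ln (\<Phi> \<theta>))))))"
proof -
  interpret cepstral_problem \<Lambda> c \<gamma> lam
    by standard (use assms in auto)
  obtain x where "is_arg_min (objective \<Lambda> c \<gamma> lam) (\<lambda>x. x \<in> feasible \<Lambda>) x"
    using minimiser_exists[OF assms(1)] .
  then have "\<exists>!x. is_arg_min (objective \<Lambda> c \<gamma> lam) (\<lambda>x. x \<in> feasible \<Lambda>) x"
    using minimiser_unique by blast
  with strictly_convex show ?thesis
    by (auto simp: Let_def dest: moment_matching)
qed

end
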